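(* Let $I$ be a finite set with $\kappa=\#I\ge2$ and suppose that there is an invertible matrix $A\in\mathbb{R}^{d\times d}$ such that $A_i=A$ for all $i\in I$. Then for each $t\ge0$, the uniform Bernoulli measure on $I^\infty$ (the Borel probability measure with $\mu([\mathtt{i}])=\kappa^{-n}$ for all $\mathtt{i}\in I^n$ and $n\in\mathbb{N}$) is the unique $t$-equilibrium measure.
   Context: $I^\infty=I^{\mathbb{N}}$ carries the product topology of the discrete set $I$, and $\sigma(i_1,i_2,\ldots)=(i_2,i_3,\ldots)$ is the left shift. For $\mathtt{i}\in I^n$, $[\mathtt{i}]$ is the cylinder of all sequences in $I^\infty$ whose initial word of length $n$ is $\mathtt{i}$, and $A_{\mathtt{i}}=A_{i_1}\cdots A_{i_n}$. $\alpha_1(A)\ge\cdots\ge\alpha_d(A)>0$ are the singular values of an invertible $A\in\mathbb{R}^{d\times d}$. The singular value function is $\varphi^t(A)=\alpha_1(A)\cdots\alpha_l(A)\,\alpha_{l+1}(A)^{t-l}$ for $0\le t<d$, $l=\lfloor t\rfloor$, and $\varphi^t(A)=|\det A|^{t/d}$ for $t\ge d$. The topological pressure is $P(t)=\lim_{n\to\infty}\frac1n\log\sum_{\mathtt{i}\in I^n}\varphi^t(A_{\mathtt{i}})$, $t\ge0$ (the limit exists by subadditivity). $\mathcal{M}_\sigma(I^\infty)$ is the set of $\sigma$-invariant Borel probability measures on $I^\infty$. For $\mu\in\mathcal{M}_\sigma(I^\infty)$, with $H(x)=-x\log x$ for $0<x\le1$ and $H(0)=0$, the entropy is $h(\mu)=\lim_{n\to\infty}\frac1n\sum_{\mathtt{i}\in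 I^n}H(\mu([\mathtt{i}]))$ and the $t$-energy is $\Lambda^t(\mu)=\lim_{n\to\infty}\frac1n\sum_{\mathtt{i}\in I^n}\mu([\mathtt{i}])\log\varphi^t(A_{\mathtt{i}})$ (both limits exist). A measure $\mu\in\mathcal{M}_\sigma(I^\infty)$ is a $t$-equilibrium measure if $P(t)=h(\mu)+\Lambda^t(\mu)$. *)

theory Defs
  imports "HOL-Analysis.Analysis" "HOL-Probability.Probability"
    "HOL-Computational_Algebra.Polynomial"
begin

definition charpoly :: "'a::comm_ring_1 ^ 'n ^ 'n \<Rightarrow> 'a poly" where
  "charpoly A = det (\<chi> i j. (if i = j then [:0, 1:] else 0) - [:A $ i $ j:])"

text \<open>The square roots of the eigenvalues of the Gram matrix, counted with algebraic
  multiplicity, in non-increasing order. All roots of this characteristic polynomial are real and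
  non-negative, so the list has length \<open>CARD('n)\<close>.\<close>

definition singular_values :: "real ^ 'n ^ 'n \<Rightarrow> real list" where
  "singular_values A =
     rev (sorted_list_of_multiset (image_mset sqrt (proots (charpoly (transpose A ** A)))))"

text \<open>Indexed from 1, so that \<open>singular_value k A\<close> is $\alpha_k(A)$ for
  \<open>1 \<le> k \<le> CARD('n)\<close>.\<close>

definition singular_value :: "nat \<Rightarrow> real ^ 'n ^ 'n \<Rightarrow> real" where
  "singular_value k A = singular_values A ! (k - 1)"

definition svf :: "real \<Rightarrow> real ^ 'n ^ 'n \<Rightarrow> real" where
  "svf t A =
     (if t < real CARD('n)
      then let l = nat \<lfloor>t\<rfloor> in
        (\<Prod>k = 1..l. singular_value k A) * singular_value (l + 1) A powr (t - real l)
      else \<bar>det A\<bar> powr (t / real CARD('n)))"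

text \<open>Infinite sequences over \<open>I\<close> are indexed from 0: the symbol $i_{k+1}$ is \<open>x k\<close>.
  Finite words are lists.\<close>

definition seq_topology :: "'i set \<Rightarrow> (nat \<Rightarrow> 'i) topology" where
  "seq_topology I = product_topology (\<lambda>_. discrete_topology I) UNIV"

definition seq_borel :: "'i set \<Rightarrow> (nat \<Rightarrow> 'i) measure" where
  "seq_borel I = sigma (topspace (seq_topology I)) {U. openin (seq_topology I) U}"

definition shift :: "(nat \<Rightarrow> 'i) \<Rightarrow> nat \<Rightarrow> 'i" where
  "shift x = (\<lambda>k. x (Suc k))"

definition words :: "'i set \<Rightarrow> nat \<Rightarrow> 'i list set" where
  "words I n = {w. set w \<subseteq> I \<and> length w = n}"

definition cylinder :: "'i set \<Rightarrow> 'i list \<Rightarrow> (nat \<Rightarrow> 'i) set" where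
  "cylinder I w = {x \<in> topspace (seq_topology I). \<forall>k < length w. x k = w ! k}"

definition word_prod :: "('i \<Rightarrow> real ^ 'n ^ 'n) \<Rightarrow> 'i list \<Rightarrow> real ^ 'n ^ 'n" where
  "word_prod A w = foldr (\<lambda>i M. A i ** M) w (mat 1)"

definition pressure :: "'i set \<Rightarrow> ('i \<Rightarrow> real ^ 'n ^ 'n) \<Rightarrow> real \<Rightarrow> real" where
  "pressure I A t = lim (\<lambda>n. ln (\<Sum>w\<in>words I n. svf t (word_prod A w)) / real n)"

definition borel_prob_measures :: "'i set \<Rightarrow> (nat \<Rightarrow> 'i) measure set" where
  "borel_prob_measures I = {\<mu>. prob_space \<mu> \<and> sets \<mu> = sets (seq_borel I)}"

definition invariant_measures :: "'i set \<Rightarrow> (nat \<Rightarrow> 'i) measure set" where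
  "invariant_measures I = {\<mu> \<in> borel_prob_measures I.
     \<forall>B\<in>sets \<mu>. measure \<mu> (shift -` B \<inter> space \<mu>) = measure \<mu> B}"

definition entropy_fun :: "real \<Rightarrow> real" where
  "entropy_fun x = (if x = 0 then 0 else - x * ln x)"

definition measure_entropy :: "'i set \<Rightarrow> (nat \<Rightarrow> 'i) measure \<Rightarrow> real" where
  "measure_entropy I \<mu> =
     lim (\<lambda>n. (\<Sum>w\<in>words I n. entropy_fun (measure \<mu> (cylinder I w))) / real n)"

definition energy ::
  "'i set \<Rightarrow> ('i \<Rightarrow> real ^ 'n ^ 'n) \<Rightarrow> real \<Rightarrow> (nat \<Rightarrow> 'i) measure \<Rightarrow> real" where
  "energy I A t \<mu> =
     lim (\<lambda>n. (\<Sum>w\<in>words I n. measure \<mu> (cylinder I w) * ln (svf t (word_prod A w))) / real n)"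

definition equilibrium_measure ::
  "'i set \<Rightarrow> ('i \<Rightarrow> real ^ 'n ^ 'n) \<Rightarrow> real \<Rightarrow> (nat \<Rightarrow> 'i) measure \<Rightarrow> bool" where
  "equilibrium_measure I A t \<mu> \<longleftrightarrow>
     \<mu> \<in> invariant_measures I \<and> pressure I A t = measure_entropy I \<mu> + energy I A t \<mu>"

definition uniform_bernoulli :: "'i set \<Rightarrow> (nat \<Rightarrow> 'i) measure \<Rightarrow> bool" where
  "uniform_bernoulli I \<mu> \<longleftrightarrow> \<mu> \<in> borel_prob_measures I \<and>
     (\<forall>n. \<forall>w\<in>words I n. measure \<mu> (cylinder I w) = 1 / real (card I) ^ n)"

end

theory Submission
  imports Defs "HOL-Computational_Algebra.Fundamental_Theorem_Algebra"
begin

text \<open>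
  Every product along a word of length \<open>n\<close> equals \<open>B\<^sup>n\<close>. With \<open>s\<^sub>n = \<phi>\<^sup>t(B\<^sup>n)\<close> the sum in the
  pressure is therefore \<open>\<kappa>\<^sup>n s\<^sub>n\<close>, while the sum in the energy of any probability measure is
  \<open>ln s\<^sub>n\<close>. Once \<open>L = lim (1/n) ln s\<^sub>n\<close> is known to exist, the pressure is \<open>ln \<kappa> + L\<close>, every energy
  is \<open>L\<close>, and an invariant measure is an equilibrium measure iff its entropy is \<open>ln \<kappa>\<close>. The
  number \<open>t\<close> has disappeared; it remains to see that the uniform Bernoulli measure is the only
  invariant measure of maximal entropy.

  Existence of \<open>L\<close> (lemma \<open>svf_growth\<close>). Below the dimension, \<open>ln \<phi>\<^sup>t\<close> is an affine combination of
  the logarithms of two products \<open>\<alpha>\<^sub>1 \<cdots> \<alpha>\<^sub>k\<close>, so these are what must grow at a definite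
  exponential rate along the powers of \<open>B\<close>. The coefficient \<open>e\<^sub>k(M)\<close> of \<open>det (x + M\<^sup>T M)\<close> is at the
  same time the \<open>k\<close>-th elementary symmetric function of the squared singular values, hence
  comparable with \<open>(\<alpha>\<^sub>1 \<cdots> \<alpha>\<^sub>k)\<^sup>2\<close> up to a factor depending on the dimension only
  (\<open>gram_coeff_bounds\<close>), and a multiple of the sum of the squares of the minors of order \<open>k\<close>, so
  that the Cauchy-Binet formula gives \<open>e\<^sub>k(M N) \<le> C e\<^sub>k(M) e\<^sub>k(N)\<close> (\<open>gram_coeff_mult_le\<close>). Fekete's
  lemma applied to \<open>ln (C e\<^sub>k(B\<^sup>n))\<close> then yields the limit; it is finite because the powers of
  \<open>B\<^sup>-\<^sup>1\<close> satisfy the same upper estimate. The two descriptions of \<open>e\<^sub>k\<close> agree because the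
  characteristic polynomial of a real symmetric matrix splits over the reals, so that the list of
  singular values is complete.

  Maximal entropy. For an invariant measure the entropies \<open>H\<^sub>n\<close> of the cylinders of length \<open>n\<close> are
  subadditive, so by Fekete's lemma the entropy is at most \<open>H\<^sub>n / n\<close> for every \<open>n\<close>. Since
  \<open>H\<^sub>n \<le> n ln \<kappa>\<close> with equality only for the uniform distribution on words, entropy \<open>ln \<kappa>\<close> forces
  \<open>\<mu>([w]) = \<kappa>\<^sup>-\<^sup>n\<close> for all words, and the cylinders determine the measure.
\<close>

section \<open>Subadditive sequences\<close>

text \<open>Writing \<open>n = q m + r\<close> gives \<open>u n \<le> q u m + u r\<close>, so \<open>u n / n\<close> is asymptotically at most
  \<open>u m / m\<close> for every \<open>m\<close>; hence \<open>u n / n\<close> tends to its infimum.\<close>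

lemma fekete:
  fixes u :: "nat \<Rightarrow> real"
  assumes sub: "\<And>m n. u (m + n) \<le> u m + u n"
    and low: "\<And>n. c * real n \<le> u n"
  obtains L where "(\<lambda>n. u n / real n) \<longlonglongrightarrow> L" and "\<And>n. n > 0 \<Longrightarrow> L \<le> u n / real n"
proof -
  define L where "L = (INF n\<in>{0<..}. u n / real n)"
  have bdd: "bdd_below ((\<lambda>n. u n / real n) ` {0<..})"
    by (rule bdd_belowI2[of _ c]) (use low in \<open>auto simp: field_simps\<close>)
  have lower: "L \<le> u n / real n" if "n > 0" for n
    unfolding L_def using that by (intro cINF_lower[OF bdd]) auto
  have mult: "u (q * m + r) \<le> real q * u m + u r" for q m r
  proof (induction q)
    case (Suc q)
    show ?case
      using sub[of m "q * m + r"] Suc by (simp add: algebra_simps)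
  qed simp
  have "(\<lambda>n. u n / real n) \<longlonglongrightarrow> L"
  proof (rule LIMSEQ_I)
    fix e :: real assume "e > 0"
    have "\<exists>m\<in>{0<..}. u m / real m < L + e / 2"
    proof (rule ccontr)
      assume "\<not> ?thesis"
      then have "L + e / 2 \<le> L"
        unfolding L_def by (intro cINF_greatest) (auto simp: not_less)
      with \<open>e > 0\<close> show False by simp
    qed
    then obtain m where m: "m > 0" "u m / real m < L + e / 2"
      by auto
    define K where "K = (\<Sum>r<m. \<bar>u r\<bar>) + \<bar>u m\<bar>"
    have upper: "u n / real n \<le> u m / real m + K / real n" if "n > 0" for n
    proof -
      define q r where "q = n div m" and "r = n mod m"
      have n: "n = q * m + r" and "r < m"
        using m by (auto simp: q_def r_def)
      have "\<bar>u r\<bar> \<le> (\<Sum>r<m. \<bar>u r\<bar>)"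
        using \<open>r < m\<close> by (intro member_le_sum) auto
      then have "u n \<le> real q * u m + (\<Sum>r<m. \<bar>u r\<bar>)"
        using mult[of q m r] n by simp
      also have "real q * u m = real n * (u m / real m) - real r * u m / real m"
        using m by (simp add: n field_simps)
      also have "- (real r * u m / real m) \<le> \<bar>u m\<bar>"
      proof -
        have "- (real r * u m / real m) \<le> (real r / real m) * \<bar>u m\<bar>"
          using m by (simp add: divide_simps) (metis abs_ge_minus_self mult_left_mono mult_minus_right of_nat_0_le_iff)
        also have "\<dots> \<le> 1 * \<bar>u m\<bar>"
          using \<open>r < m\<close> by (intro mult_right_mono) auto
        finally show ?thesis by simp
      qed
      then have "real n * (u m / real m) - real r * u m / real m + (\<Sum>r<m. \<bar>u r\<bar>)
          \<le> real n * (u m / real m) + K"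
        by (simp add: K_def)
      finally have "u n \<le> real n * (u m / real m) + K" by simp
      then have "u n / real n \<le> (real n * (u m / real m) + K) / real n"
        by (rule divide_right_mono) simp
      then show ?thesis
        using that by (simp add: add_divide_distrib)
    qed
    have "(\<lambda>n. K / real n) \<longlonglongrightarrow> 0"
      by (rule lim_const_over_n)
    then have "\<forall>\<^sub>F n in sequentially. \<bar>K / real n\<bar> < e / 2"
      using \<open>e > 0\<close> tendstoD[of "\<lambda>n. K / real n" 0 sequentially "e / 2"]
      by (simp add: dist_real_def)
    then obtain N where N: "\<And>n. n \<ge> N \<Longrightarrow> \<bar>K / real n\<bar> < e / 2"
      by (auto simp: eventually_sequentially)
    have "norm (u n / real n - L) < e" if "n \<ge> max N 1" for n
    proof -
      have "n \<ge> N" and "n > 0" using that by auto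
      have "u n / real n < L + e"
        using upper[OF \<open>n > 0\<close>] N[OF \<open>n \<ge> N\<close>] m(2) by linarith
      with lower[OF \<open>n > 0\<close>] show ?thesis
        using \<open>e > 0\<close> by (simp add: abs_less_iff)
    qed
    then show "\<exists>no. \<forall>n\<ge>no. norm (u n / real n - L) < e"
      by blast
  qed
  with lower that show ?thesis by blast
qed

section \<open>Real symmetric matrices have real characteristic roots\<close>

lemma map_poly_of_real_mult:
  "map_poly complex_of_real (p * q) = map_poly of_real p * map_poly of_real q"
  by (rule poly_eqI) (simp add: coeff_map_poly coeff_mult)

lemma poly_map_poly_of_real:
  "poly (map_poly complex_of_real p) (of_real x) = of_real (poly p x)"
  by (simp add: poly_altdef coeff_map_poly degree_map_poly)

text \<open>A complex root of \<open>p\<close> exists by the fundamental theorem of algebra and is real by assumption,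
  so it can be split off over the reals.\<close>

lemma real_rooted_poly_decompose:
  fixes p :: "real poly"
  assumes "p \<noteq> 0" and "\<And>z :: complex. poly (map_poly of_real p) z = 0 \<Longrightarrow> z \<in> \<real>"
  shows "p = smult (lead_coeff p) (\<Prod>x\<in>#proots p. [:-x, 1:])"
  using assms
proof (induction "degree p" arbitrary: p)
  case 0
  then obtain c where "p = [:c:]" "c \<noteq> 0"
    by (metis degree_eq_zeroE pCons_0_0)
  then show ?case by simp
next
  case (Suc n)
  have "degree (map_poly complex_of_real p) = Suc n"
    using Suc.hyps(2) by (simp add: degree_map_poly)
  then have "\<not> constant (poly (map_poly complex_of_real p))"
    using constant_degree by (metis nat.distinct(1))
  then obtain z where z: "poly (map_poly complex_of_real p) z = 0"
    using fundamental_theorem_of_algebra by blast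
  then obtain x where x: "z = complex_of_real x"
    using Suc.prems(2) by (auto elim!: Reals_cases)
  have "poly (map_poly complex_of_real p) (of_real x) = of_real (poly p x)"
    by (rule poly_map_poly_of_real)
  then have "poly p x = 0"
    using z x by simp
  then obtain q where q: "p = [:-x, 1:] * q"
    using poly_eq_0_iff_dvd by (metis dvdE)
  then have "q \<noteq> 0" using Suc.prems(1) by auto
  have "degree q = n"
    using Suc.hyps(2) \<open>q \<noteq> 0\<close> unfolding q by (simp add: degree_mult_eq del: mult_pCons_left)
  have "w \<in> \<real>" if "poly (map_poly of_real q) w = 0" for w :: complex
  proof (rule Suc.prems(2))
    show "poly (map_poly of_real p) w = 0"
      unfolding q using that by (simp only: map_poly_of_real_mult poly_mult mult_zero_right)
  qed
  then have IH: "q = smult (lead_coeff q) (\<Prod>x\<in>#proots q. [:-x, 1:])"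
    using Suc.hyps(1) \<open>degree q = n\<close> \<open>q \<noteq> 0\<close> by blast
  have "proots p = add_mset x (proots q)"
    unfolding q using \<open>q \<noteq> 0\<close> by (subst proots_mult) auto
  moreover have "lead_coeff p = lead_coeff q"
    unfolding q by (simp only: lead_coeff_mult) simp
  ultimately show ?case
    using IH q by (metis (no_types, lifting) image_mset_add_mset mult_smult_right prod_mset.add_mset)
qed

text \<open>If \<open>S v = z v\<close> then \<open>z |v|\<^sup>2\<close> is the value \<open>w\<close> at \<open>v\<close> of the Hermitian form with matrix \<open>S\<close>, and
  the symmetry of \<open>S\<close> makes \<open>w\<close> its own conjugate.\<close>

lemma real_eigenvalue_of_symmetric:
  fixes S :: "real ^ 'n ^ 'n" and z :: complex
  assumes sym: "\<And>i j. S $ i $ j = S $ j $ i"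
    and "det (\<chi> i j. (if i = j then z else 0) - of_real (S $ i $ j) :: complex ^ 'n ^ 'n) = 0"
  shows "z \<in> \<real>"
proof -
  define T :: "complex ^ 'n ^ 'n" where "T = (\<chi> i j. (if i = j then z else 0) - of_real (S $ i $ j))"
  have "\<not> invertible T"
    using assms(2) by (simp add: T_def invertible_det_nz)
  then obtain v where v: "T *v v = 0" "v \<noteq> 0"
    using matrix_left_invertible_ker[of T] by (auto simp: invertible_left_inverse)
  have eig: "z * v $ i = (\<Sum>j\<in>UNIV. of_real (S $ i $ j) * v $ j)" for i
  proof -
    have "(T *v v) $ i = 0"
      using v(1) by simp
    moreover have "(T *v v) $ i = (\<Sum>j\<in>UNIV. (if i = j then z * v $ j else 0))
        - (\<Sum>j\<in>UNIV. of_real (S $ i $ j) * v $ j)"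
      unfolding T_def matrix_vector_mult_def sum_subtractf[symmetric]
      by (auto simp: algebra_simps intro!: sum.cong)
    ultimately show ?thesis
      by simp
  qed
  define N where "N = (\<Sum>i\<in>UNIV. (cmod (v $ i))\<^sup>2)"
  define w where "w = (\<Sum>i\<in>UNIV. \<Sum>j\<in>UNIV. of_real (S $ i $ j) * (cnj (v $ i) * v $ j))"
  obtain i where "v $ i \<noteq> 0"
    using v(2) by (auto simp: vec_eq_iff)
  then have "N > 0"
    unfolding N_def by (intro sum_pos2[of _ i]) auto
  have "z * of_real N = (\<Sum>i\<in>UNIV. cnj (v $ i) * (z * v $ i))"
    unfolding N_def of_real_sum complex_norm_square sum_distrib_left by (simp add: mult_ac)
  also have "\<dots> = w"
    unfolding eig w_def by (simp add: sum_distrib_left mult_ac)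
  finally have zN: "z * of_real N = w" .
  have "cnj w = (\<Sum>i\<in>UNIV. \<Sum>j\<in>UNIV. of_real (S $ i $ j) * (v $ i * cnj (v $ j)))"
    by (simp add: w_def cnj_sum)
  also have "\<dots> = (\<Sum>j\<in>UNIV. \<Sum>i\<in>UNIV. of_real (S $ i $ j) * (v $ i * cnj (v $ j)))"
    by (rule sum.swap)
  also have "\<dots> = w"
    unfolding w_def by (subst sym) (simp add: mult_ac)
  finally have "w \<in> \<real>"
    by (simp add: Reals_cnj_iff)
  moreover have "z = w / of_real N"
    using zN \<open>N > 0\<close> by (simp add: field_simps)
  ultimately show ?thesis
    by simp
qed

section \<open>Minors and the Cauchy-Binet formula\<close>

text \<open>The rows and columns of the submatrix are given by functions on \<open>J\<close>, which serves only as an index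
  set. The functions may repeat values, so that sums over all of them need no choice of an order of
  rows or columns, at the price of counting each minor several times.\<close>

definition minor ::
  "'n set \<Rightarrow> 'a::comm_ring_1 ^ 'n ^ 'n \<Rightarrow> ('n \<Rightarrow> 'n) \<Rightarrow> ('n \<Rightarrow> 'n) \<Rightarrow> 'a" where
  "minor J M a b = (\<Sum>p | p permutes J. of_int (sign p) * (\<Prod>i\<in>J. M $ a i $ b (p i)))"

lemma minor_cong:
  assumes "\<And>i. i \<in> J \<Longrightarrow> a i = a' i" "\<And>i. i \<in> J \<Longrightarrow> b i = b' i"
  shows "minor J M a b = minor J M a' b'"
  unfolding minor_def using assms
  by (intro sum.cong prod.cong refl arg_cong2[where f = "(*)"]) (auto simp: permutes_in_image)

lemma minor_permute_cols:
  fixes q :: "'n \<Rightarrow> 'n::finite"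
  assumes q: "q permutes J"
  shows "minor J M a (b \<circ> q) = of_int (sign q) * minor J M a b"
proof -
  have "of_int (sign q) * minor J M a b = (\<Sum>p | p permutes J.
      of_int (sign q) * (of_int (sign (q \<circ> p)) * (\<Prod>i\<in>J. M $ a i $ b ((q \<circ> p) i))))"
    unfolding minor_def sum_distrib_left
    by (subst setum_permutations_compose_left[OF q]) simp
  also have "\<dots> = (\<Sum>p | p permutes J. of_int (sign p) * (\<Prod>i\<in>J. M $ a i $ (b \<circ> q) (p i)))"
  proof (rule sum.cong)
    fix p assume "p \<in> {p. p permutes J}"
    then have "permutation p" "permutation q"
      using q by (auto intro: permutation_permutes[THEN iffD2] simp: permutation_permutes)
    then have "sign q * sign (q \<circ> p) = sign p"
      by (simp add: sign_compose)
    then show "of_int (sign q) * (of_int (sign (q \<circ> p)) * (\<Prod>i\<in>J. M $ a i $ b ((q \<circ> p) i)))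
        = of_int (sign p) * (\<Prod>i\<in>J. M $ a i $ (b \<circ> q) (p i))"
      by (simp flip: mult.assoc of_int_mult)
  qed simp
  finally show ?thesis
    by (simp add: minor_def)
qed

lemma minor_transpose:
  fixes M :: "'a::comm_ring_1 ^ 'n ^ 'n"
  shows "minor J (transpose M) a b = minor J M b a"
proof -
  have "minor J (transpose M) a b
      = (\<Sum>p | p permutes J. of_int (sign (inv p)) * (\<Prod>i\<in>J. M $ b (inv p i) $ a i))"
    unfolding minor_def transpose_def by (subst sum_permutations_inverse) simp
  also have "\<dots> = minor J M b a"
    unfolding minor_def
  proof (rule sum.cong)
    fix p assume "p \<in> {p. p permutes J}"
    then have p: "p permutes J" by simp
    have "(\<Prod>i\<in>J. M $ b (inv p i) $ a i) = (\<Prod>i\<in>J. M $ b (inv p (p i)) $ a (p i))"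
      by (subst prod.permute[OF p]) (simp add: o_def)
    also have "\<dots> = (\<Prod>i\<in>J. M $ b i $ a (p i))"
      using p by (simp add: permutes_inverses)
    finally show "of_int (sign (inv p)) * (\<Prod>i\<in>J. M $ b (inv p i) $ a i)
        = of_int (sign p) * (\<Prod>i\<in>J. M $ b i $ a (p i))"
      using p by (simp add: sign_inverse permutes_imp_permutation[OF finite])
  qed simp
  finally show ?thesis .
qed

lemma minor_permute_rows:
  fixes q :: "'n \<Rightarrow> 'n::finite"
  assumes "q permutes J"
  shows "minor J M (a \<circ> q) b = of_int (sign q) * minor J M a b"
  by (metis minor_transpose minor_permute_cols[OF assms])

lemma minor_eq_0_if_not_inj:
  fixes M :: "'a::{idom, ring_char_0} ^ 'n ^ 'n"
  assumes "\<not> inj_on b J"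
  shows "minor J M a b = 0"
proof -
  obtain i j where ij: "i \<in> J" "j \<in> J" "i \<noteq> j" "b i = b j"
    using assms by (auto simp: inj_on_def)
  define q where "q = Transposition.transpose i j"
  have "b \<circ> q = b"
    using ij by (auto simp: fun_eq_iff q_def Transposition.transpose_def)
  moreover have "q permutes J"
    using ij by (simp add: q_def permutes_swap_id)
  moreover have "sign q = -1"
    using ij by (simp add: q_def sign_swap_id)
  ultimately have "minor J M a b = - minor J M a b"
    using minor_permute_cols[of q J M a b] by simp
  then show ?thesis by simp
qed

lemma minor_mult_expand:
  fixes M N :: "'a::comm_ring_1 ^ 'n ^ 'n"
  shows "minor J (M ** N) a c
      = (\<Sum>b\<in>J \<rightarrow>\<^sub>E UNIV. (\<Prod>i\<in>J. M $ a i $ b i) * minor J N b c)"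
proof -
  have "minor J (M ** N) a c = (\<Sum>p | p permutes J. of_int (sign p) *
      (\<Sum>b\<in>J \<rightarrow>\<^sub>E UNIV. \<Prod>i\<in>J. M $ a i $ b i * N $ b i $ c (p i)))"
    unfolding minor_def matrix_matrix_mult_def
    by (simp add: prod_sum_PiE)
  also have "\<dots> = (\<Sum>b\<in>J \<rightarrow>\<^sub>E UNIV. \<Sum>p | p permutes J. of_int (sign p) *
      (\<Prod>i\<in>J. M $ a i $ b i * N $ b i $ c (p i)))"
    unfolding sum_distrib_left by (rule sum.swap)
  also have "\<dots> = (\<Sum>b\<in>J \<rightarrow>\<^sub>E UNIV. (\<Prod>i\<in>J. M $ a i $ b i) * minor J N b c)"
    unfolding minor_def sum_distrib_left by (simp add: prod.distrib mult_ac)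
  finally show ?thesis .
qed

text \<open>Expanding each row of the product gives
  \<open>\<Sum>\<^sub>b (\<Prod>\<^sub>i M(a i, b i)) * minor J N b c\<close>. Replacing \<open>b\<close> by \<open>b \<circ> q\<close> multiplies the minor by \<open>sign q\<close>;
  adding the resulting expressions over all permutations \<open>q\<close> of \<open>J\<close> turns the row products into minors
  of \<open>M\<close> and accounts for the factorial on the left.\<close>

lemma cauchy_binet:
  fixes M N :: "'a::{comm_ring_1, ring_char_0} ^ 'n ^ 'n"
  shows "fact (card J) * minor J (M ** N) a c
      = (\<Sum>b\<in>J \<rightarrow>\<^sub>E UNIV. minor J M a b * minor J N b c)"
proof -
  have reindex: "bij_betw (\<lambda>b. b \<circ> q) (J \<rightarrow>\<^sub>E (UNIV :: 'n set)) (J \<rightarrow>\<^sub>E UNIV)"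
    if q: "q permutes J" for q
  proof (rule bij_betwI[where g = "\<lambda>b. b \<circ> inv q"])
    show "(\<lambda>b. b \<circ> q) \<in> (J \<rightarrow>\<^sub>E UNIV) \<rightarrow> (J \<rightarrow>\<^sub>E (UNIV :: 'n set))"
      using q by (auto simp: PiE_def extensional_def permutes_in_image)
    show "(\<lambda>b. b \<circ> inv q) \<in> (J \<rightarrow>\<^sub>E UNIV) \<rightarrow> (J \<rightarrow>\<^sub>E (UNIV :: 'n set))"
      using permutes_inv[OF q] by (auto simp: PiE_def extensional_def permutes_in_image)
  qed (use q in \<open>auto simp: fun_eq_iff permutes_inverses\<close>)
  have each: "minor J (M ** N) a c = (\<Sum>b\<in>J \<rightarrow>\<^sub>E UNIV.
      of_int (sign q) * (\<Prod>i\<in>J. M $ a i $ b (q i)) * minor J N b c)" if q: "q permutes J" for q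
  proof -
    have "minor J (M ** N) a c
        = (\<Sum>b\<in>J \<rightarrow>\<^sub>E UNIV. (\<Prod>i\<in>J. M $ a i $ (b \<circ> q) i) * minor J N (b \<circ> q) c)"
      unfolding minor_mult_expand by (rule sum.reindex_bij_betw[OF reindex[OF q], symmetric])
    then show ?thesis
      by (simp add: minor_permute_rows[OF q] mult_ac)
  qed
  have "fact (card J) * minor J (M ** N) a c = (\<Sum>q | q permutes J. minor J (M ** N) a c)"
    by (simp add: card_permutations)
  also have "\<dots> = (\<Sum>q | q permutes J. \<Sum>b\<in>J \<rightarrow>\<^sub>E UNIV.
      of_int (sign q) * (\<Prod>i\<in>J. M $ a i $ b (q i)) * minor J N b c)"
    using each by (intro sum.cong) auto
  also have "\<dots> = (\<Sum>b\<in>J \<rightarrow>\<^sub>E UNIV. minor J M a b * minor J N b c)"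
    unfolding minor_def[of J M] sum_distrib_right by (rule sum.swap)
  finally show ?thesis .
qed

lemma minor_gram:
  fixes M :: "real ^ 'n ^ 'n"
  shows "fact (card J) * minor J (transpose M ** M) id id
      = (\<Sum>b\<in>J \<rightarrow>\<^sub>E UNIV. (minor J M b id)\<^sup>2)"
  by (simp add: cauchy_binet minor_transpose power2_eq_square)

text \<open>In the Leibniz formula, expand each product according to the set \<open>J\<close> of indices at which the entry
  of \<open>- S\<close> is taken. Off \<open>J\<close> only fixed points contribute, which leaves the permutations of \<open>J\<close>.\<close>

lemma det_diagonal_minus:
  fixes S :: "'a::comm_ring_1 ^ 'n ^ 'n"
  shows "det (\<chi> i j. (if i = j then x else 0) - S $ i $ j)
      = (\<Sum>J\<in>UNIV. (-1) ^ card J * minor J S id id * x ^ (CARD('n) - card J))"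
proof -
  have "det (\<chi> i j. (if i = j then x else 0) - S $ i $ j)
      = (\<Sum>p | p permutes UNIV. of_int (sign p) *
          (\<Prod>i\<in>UNIV. - S $ i $ p i + (if i = p i then x else 0)))"
    by (simp add: det_def)
  also have "\<dots> = (\<Sum>p | p permutes UNIV. \<Sum>J\<in>UNIV. of_int (sign p) *
          ((\<Prod>i\<in>J. - S $ i $ p i) * (\<Prod>i\<in>-J. if i = p i then x else 0)))"
    by (subst prod_add) (simp_all add: sum_distrib_left Compl_eq_Diff_UNIV)
  also have "\<dots> = (\<Sum>J\<in>UNIV. \<Sum>p | p permutes UNIV. of_int (sign p) *
          ((\<Prod>i\<in>J. - S $ i $ p i) * (\<Prod>i\<in>-J. if i = p i then x else 0)))"
    by (rule sum.swap)
  also have "\<dots> = (\<Sum>J\<in>UNIV. (-1) ^ card J * minor J S id id * x ^ (CARD('n) - card J))"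
  proof (rule sum.cong[OF refl])
    fix J :: "'n set"
    have "(\<Sum>p | p permutes UNIV. of_int (sign p) *
          ((\<Prod>i\<in>J. - S $ i $ p i) * (\<Prod>i\<in>-J. if i = p i then x else 0)))
        = (\<Sum>p | p permutes J. of_int (sign p) *
          ((\<Prod>i\<in>J. - S $ i $ p i) * (\<Prod>i\<in>-J. if i = p i then x else 0)))"
    proof (rule sum.mono_neutral_right)
      show "{p. p permutes J} \<subseteq> {p. p permutes UNIV}"
        using permutes_subset by blast
      show "\<forall>p\<in>{p. p permutes UNIV} - {p. p permutes J}. of_int (sign p) *
          ((\<Prod>i\<in>J. - S $ i $ p i) * (\<Prod>i\<in>-J. if i = p i then x else 0)) = 0"
      proof
        fix p assume p: "p \<in> {p. p permutes (UNIV :: 'n set)} - {p. p permutes J}"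
        then have "\<exists>i\<in>-J. i \<noteq> p i"
          by (auto simp: permutes_def) (metis ComplI)
        then have "(\<Prod>i\<in>-J. if i = p i then x else 0) = 0"
          by (auto intro!: prod_zero)
        then show "of_int (sign p) *
          ((\<Prod>i\<in>J. - S $ i $ p i) * (\<Prod>i\<in>-J. if i = p i then x else 0)) = 0"
          by simp
      qed
    qed simp
    also have "\<dots> = (\<Sum>p | p permutes J. of_int (sign p) *
          ((\<Prod>i\<in>J. - S $ i $ p i) * x ^ (CARD('n) - card J)))"
    proof (rule sum.cong[OF refl])
      fix p assume "p \<in> {p. p permutes J}"
      then have "(\<Prod>i\<in>-J. if i = p i then x else 0) = (\<Prod>i\<in>-J. x)"
        by (intro prod.cong) (auto simp: permutes_not_in)
      then show "of_int (sign p) *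
          ((\<Prod>i\<in>J. - S $ i $ p i) * (\<Prod>i\<in>-J. if i = p i then x else 0))
        = of_int (sign p) * ((\<Prod>i\<in>J. - S $ i $ p i) * x ^ (CARD('n) - card J))"
        by (simp add: Compl_eq_Diff_UNIV card_Diff_subset)
    qed
    also have "\<dots> = (-1) ^ card J * minor J S id id * x ^ (CARD('n) - card J)"
      unfolding minor_def by (simp add: prod_uminus sum_distrib_left sum_distrib_right mult_ac)
    finally show "(\<Sum>p | p permutes UNIV. of_int (sign p) *
          ((\<Prod>i\<in>J. - S $ i $ p i) * (\<Prod>i\<in>-J. if i = p i then x else 0)))
        = (-1) ^ card J * minor J S id id * x ^ (CARD('n) - card J)" .
  qed
  finally show ?thesis .
qed

section \<open>The characteristic polynomial of a Gram matrix\<close>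

lemma poly_det:
  fixes P :: "'a::comm_ring_1 poly ^ 'n ^ 'n"
  shows "poly (det P) x = det (\<chi> i j. poly (P $ i $ j) x)"
  by (simp add: det_def poly_sum poly_prod)

lemma poly_charpoly: "poly (charpoly S) x = det (\<chi> i j. (if i = j then x else 0) - S $ i $ j)"
  unfolding charpoly_def poly_det by (intro arg_cong[of _ _ det]) (simp add: vec_eq_iff)

lemma charpoly_eq_sum_minors:
  fixes S :: "real ^ 'n ^ 'n"
  shows "charpoly S = (\<Sum>J\<in>UNIV. monom ((-1) ^ card J * minor J S id id) (CARD('n) - card J))"
  by (intro iffD1[OF poly_eq_poly_eq_iff] ext)
    (simp add: poly_charpoly det_diagonal_minus poly_sum poly_monom)

lemma lead_coeff_charpoly:
  fixes S :: "real ^ 'n ^ 'n"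
  shows "degree (charpoly S) = CARD('n)" "lead_coeff (charpoly S) = 1"
proof -
  have card_0: "CARD('n) - card J = CARD('n) \<longleftrightarrow> J = {}" for J :: "'n set"
  proof -
    have "card J \<le> CARD('n)" "CARD('n) > 0"
      by (simp_all add: card_mono)
    then have "CARD('n) - card J = CARD('n) \<longleftrightarrow> card J = 0"
      by arith
    then show ?thesis
      by simp
  qed
  have 1: "coeff (charpoly S) (CARD('n)) = 1"
    unfolding charpoly_eq_sum_minors by (simp add: coeff_sum coeff_monom card_0 minor_def)
  moreover have "degree (charpoly S) \<le> CARD('n)"
    unfolding charpoly_eq_sum_minors
    by (intro degree_sum_le) (auto intro: order.trans[OF degree_monom_le])
  ultimately show "degree (charpoly S) = CARD('n)"
    by (metis le_antisym le_degree zero_neq_one)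
  with 1 show "lead_coeff (charpoly S) = 1"
    by simp
qed

lemma poly_charpoly_of_real:
  fixes S :: "real ^ 'n ^ 'n"
  shows "poly (map_poly complex_of_real (charpoly S)) z
      = det (\<chi> i j. (if i = j then z else 0) - of_real (S $ i $ j) :: complex ^ 'n ^ 'n)"
proof -
  have "map_poly complex_of_real (charpoly S)
      = (\<Sum>J\<in>UNIV. monom (of_real ((-1) ^ card J * minor J S id id)) (CARD('n) - card J))"
    by (rule poly_eqI) (auto simp: charpoly_eq_sum_minors coeff_map_poly coeff_sum coeff_monom intro!: sum.cong)
  moreover have "minor J (\<chi> i j. complex_of_real (S $ i $ j)) id id = of_real (minor J S id id)" for J
    by (simp add: minor_def)
  ultimately show ?thesis
    using det_diagonal_minus[of z "\<chi> i j. complex_of_real (S $ i $ j)"]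
    by (simp add: poly_sum poly_monom)
qed

lemma charpoly_symmetric_splits:
  fixes S :: "real ^ 'n ^ 'n"
  assumes "transpose S = S"
  shows "charpoly S = (\<Prod>x\<in>#proots (charpoly S). [:-x, 1:])"
proof -
  have "S $ i $ j = S $ j $ i" for i j
    using arg_cong[OF assms, of "\<lambda>T. T $ j $ i"] by (simp add: transpose_def)
  then have "z \<in> \<real>" if "poly (map_poly of_real (charpoly S)) z = 0" for z :: complex
    using real_eigenvalue_of_symmetric[of S z] that by (simp add: poly_charpoly_of_real)
  moreover have "charpoly S \<noteq> 0"
    using lead_coeff_charpoly[of S] by auto
  ultimately have "charpoly S = smult (lead_coeff (charpoly S)) (\<Prod>x\<in>#proots (charpoly S). [:-x, 1:])"
    by (intro real_rooted_poly_decompose)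
  also have "\<dots> = (\<Prod>x\<in>#proots (charpoly S). [:-x, 1:])"
    by (simp only: lead_coeff_charpoly(2) smult_1_left)
  finally show ?thesis .
qed

text \<open>Comparison of the coefficients of \<open>x ^ (d - k)\<close>.\<close>

lemma eq_coeffs_by_card:
  fixes f :: "'b set \<Rightarrow> real" and g :: "'c set \<Rightarrow> real"
  assumes A: "finite A" "card A = d" and B: "finite B" "card B = d" and "k \<le> d"
    and eq: "\<And>x. (\<Sum>J\<in>Pow A. f J * x ^ (d - card J)) = (\<Sum>J\<in>Pow B. g J * x ^ (d - card J))"
  shows "(\<Sum>J | J \<subseteq> A \<and> card J = k. f J) = (\<Sum>J | J \<subseteq> B \<and> card J = k. g J)"
proof -
  have coeff: "coeff (\<Sum>J\<in>Pow C. monom (h J) (d - card J)) (d - k)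
      = (\<Sum>J | J \<subseteq> C \<and> card J = k. h J)"
    if C: "finite C" "card C = d" for C :: "'z set" and h :: "'z set \<Rightarrow> real"
  proof -
    have "d - card J = d - k \<longleftrightarrow> card J = k" if "J \<in> Pow C" for J
      using card_mono[of C J] C that \<open>k \<le> d\<close> by auto
    then have "coeff (\<Sum>J\<in>Pow C. monom (h J) (d - card J)) (d - k)
        = (\<Sum>J\<in>Pow C. if card J = k then h J else 0)"
      by (auto simp: coeff_sum coeff_monom intro!: sum.cong)
    also have "\<dots> = (\<Sum>J | J \<subseteq> C \<and> card J = k. h J)"
      using C by (subst sum.inter_filter[symmetric]) (auto simp: Pow_def)
    finally show ?thesis .
  qed
  have "(\<Sum>J\<in>Pow A. monom (f J) (d - card J)) = (\<Sum>J\<in>Pow B. monom (g J) (d - card J))"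
    by (intro iffD1[OF poly_eq_poly_eq_iff] ext) (simp add: poly_sum poly_monom eq)
  with coeff[OF A, of f] coeff[OF B, of g] show ?thesis
    by simp
qed

text \<open>The coefficient of \<open>x ^ (CARD('n) - k)\<close> in \<open>det (x + M\<^sup>T M)\<close>. By \<open>minor_gram\<close> it is, up to the factor
  \<open>k!\<close>, a sum of squares of minors of \<open>M\<close>, that is, essentially the squared Euclidean norm of the
  \<open>k\<close>-th exterior power of \<open>M\<close>.\<close>

definition gram_coeff :: "nat \<Rightarrow> real ^ 'n ^ 'n \<Rightarrow> real" where
  "gram_coeff k M = (\<Sum>J | card J = k. minor J (transpose M ** M) id id)"

lemma minor_gram_nonneg:
  fixes M :: "real ^ 'n ^ 'n"
  shows "minor J (transpose M ** M) id id \<ge> 0"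
proof -
  have "0 \<le> fact (card J) * minor J (transpose M ** M) id id"
    unfolding minor_gram by (intro sum_nonneg) simp
  then show ?thesis
    using mult_le_cancel_left_pos[OF fact_gt_zero[of "card J"], where a = 0] by (metis mult_zero_right)
qed

lemma poly_charpoly_gram:
  fixes M :: "real ^ 'n ^ 'n"
  shows "(-1) ^ CARD('n) * poly (charpoly (transpose M ** M)) (-x)
    = (\<Sum>J\<in>UNIV. minor J (transpose M ** M) id id * x ^ (CARD('n) - card J))"
proof -
  have "(-1) ^ CARD('n) * ((-1) ^ card J * m * (-x) ^ (CARD('n) - card J)) = m * x ^ (CARD('n) - card J)"
    for m and J :: "'n set"
  proof -
    have "card J \<le> CARD('n)"
      by (simp add: card_mono)
    then have "(-1 :: real) ^ card J * (-1) ^ (CARD('n) - card J) = (-1) ^ CARD('n)"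
      by (metis le_add_diff_inverse power_add)
    then have "(-1) ^ CARD('n) * ((-1 :: real) ^ card J * (-1) ^ (CARD('n) - card J)) = 1"
      by (simp add: left_minus_one_mult_self)
    moreover have "(-1) ^ CARD('n) * ((-1) ^ card J * m * (-x) ^ (CARD('n) - card J))
        = ((-1) ^ CARD('n) * ((-1) ^ card J * (-1) ^ (CARD('n) - card J))) * (m * x ^ (CARD('n) - card J))"
      by (subst power_minus[of x]) (simp only: mult_ac)
    ultimately show ?thesis
      by simp
  qed
  then show ?thesis
    unfolding poly_charpoly det_diagonal_minus sum_distrib_left by (intro sum.cong refl) blast
qed

text \<open>At \<open>-x\<close> with \<open>x \<ge> 0\<close> the characteristic polynomial is, up to sign, a polynomial in \<open>x\<close> with nonnegative
  coefficients and constant term \<open>(det M)\<^sup>2 > 0\<close>.\<close>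

lemma gram_eigenvalue_pos:
  fixes M :: "real ^ 'n ^ 'n"
  assumes "invertible M" "x \<in># proots (charpoly (transpose M ** M))"
  shows "x > 0"
proof -
  have "charpoly (transpose M ** M) \<noteq> 0"
    using lead_coeff_charpoly[of "transpose M ** M"] by auto
  then have "poly (charpoly (transpose M ** M)) x = 0"
    using assms(2) by simp
  then have root: "(\<Sum>J\<in>UNIV. minor J (transpose M ** M) id id * (-x) ^ (CARD('n) - card J)) = 0"
    using poly_charpoly_gram[of M "-x"] by simp
  show ?thesis
  proof (rule ccontr)
    assume "\<not> x > 0"
    then have nonneg: "minor J (transpose M ** M) id id * (-x) ^ (CARD('n) - card J) \<ge> 0" for J
      by (intro mult_nonneg_nonneg minor_gram_nonneg) auto
    have "minor UNIV (transpose M ** M) id id = (det M)\<^sup>2"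
      by (simp add: minor_def det_def[symmetric] det_mul power2_eq_square)
    then have "minor UNIV (transpose M ** M) id id > 0"
      using assms(1) by (simp add: invertible_det_nz)
    then have "(\<Sum>J\<in>UNIV. minor J (transpose M ** M) id id * (-x) ^ (CARD('n) - card J)) > 0"
      using nonneg by (intro sum_pos2[of UNIV UNIV]) auto
    with root show False by simp
  qed
qed

lemma mset_singular_values:
  "mset (singular_values M) = image_mset sqrt (proots (charpoly (transpose M ** M)))"
  by (simp add: singular_values_def)

text \<open>The characteristic polynomial splits, so the multiset of its real roots has full size. Hence
  \<open>singular_value k M\<close> is a genuine list entry for \<open>1 \<le> k \<le> CARD('n)\<close>.\<close>

lemma length_singular_values: "length (singular_values (M :: real ^ 'n ^ 'n)) = CARD('n)"
proof -
  let ?S = "transpose M ** M"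
  have "transpose ?S = ?S"
    by (simp add: matrix_transpose_mul)
  then have "degree (charpoly ?S) = degree (\<Prod>x\<in>#proots (charpoly ?S). [:-x, 1:])"
    using charpoly_symmetric_splits by metis
  moreover have "degree (\<Prod>x\<in>#X. [:-x, 1:]) = size X" for X :: "real multiset"
  proof (induction X)
    case (add x X)
    moreover have "(\<Prod>x\<in>#X. [:-x, 1:]) \<noteq> 0"
      by (auto simp: prod_mset_zero_iff)
    ultimately show ?case
      by (simp add: degree_mult_eq del: mult_pCons_left)
  qed simp
  ultimately have "size (proots (charpoly ?S)) = CARD('n)"
    by (simp add: lead_coeff_charpoly)
  then show ?thesis
    using arg_cong[OF mset_singular_values[of M], of size] by simp
qed

lemma singular_values_pos: "invertible M \<Longrightarrow> x \<in> set (singular_values M) \<Longrightarrow> x > 0"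
  using gram_eigenvalue_pos[of M] arg_cong[OF mset_singular_values[of M], of set_mset]
  by auto

lemma singular_values_antimono:
  assumes "i \<le> j" "j < length (singular_values M)"
  shows "singular_values M ! j \<le> singular_values M ! i"
  using assms sorted_rev_nth_mono[of "singular_values M" i j] by (simp add: singular_values_def)

text \<open>Both sides are coefficients of \<open>det (x + M\<^sup>T M) = \<Prod>\<^sub>i (\<alpha>\<^sub>i\<^sup>2 + x)\<close>.\<close>

lemma gram_coeff_eq_elementary_symmetric:
  fixes M :: "real ^ 'n ^ 'n"
  assumes "invertible M" "k \<le> CARD('n)"
  shows "gram_coeff k M
      = (\<Sum>J | J \<subseteq> {..<CARD('n)} \<and> card J = k. \<Prod>i\<in>J. (singular_values M ! i)\<^sup>2)"
proof -
  let ?S = "transpose M ** M" and ?s = "singular_values M"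
  have "transpose ?S = ?S"
    by (simp add: matrix_transpose_mul)
  note split = charpoly_symmetric_splits[OF this]
  have size: "size (proots (charpoly ?S)) = CARD('n)"
    using arg_cong[OF mset_singular_values[of M], of size] by (simp add: length_singular_values)
  have "(\<Sum>J\<in>UNIV. minor J ?S id id * x ^ (CARD('n) - card J))
      = (\<Prod>i<CARD('n). (?s ! i)\<^sup>2 + x)" for x
  proof -
    have "(\<Sum>J\<in>UNIV. minor J ?S id id * x ^ (CARD('n) - card J))
        = (-1) ^ CARD('n) * poly (charpoly ?S) (-x)"
      by (rule poly_charpoly_gram[symmetric])
    also have "poly (charpoly ?S) (-x) = (\<Prod>y\<in>#proots (charpoly ?S). -(y + x))"
      by (subst split) (simp add: poly_prod_mset image_mset.compositionality o_def)
    also have "(-1) ^ CARD('n) * \<dots> = (\<Prod>y\<in>#proots (charpoly ?S). y + x)"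
    proof -
      have "(-1) ^ size X * (\<Prod>y\<in>#X. -(y + x)) = (\<Prod>y\<in>#X. y + x)" for X
        by (induction X) (auto simp: algebra_simps)
      from this[of "proots (charpoly ?S)"] show ?thesis
        by (simp add: size)
    qed
    also have "\<dots> = (\<Prod>y\<in>#image_mset sqrt (proots (charpoly ?S)). y\<^sup>2 + x)"
      using gram_eigenvalue_pos[OF assms(1)]
      by (auto simp: multiset.map_comp o_def less_imp_le intro!: arg_cong[of _ _ prod_mset] image_mset_cong)
    also have "\<dots> = (\<Prod>y\<leftarrow>?s. y\<^sup>2 + x)"
      unfolding mset_singular_values[symmetric] mset_map[symmetric] by (rule prod_mset_prod_list)
    also have "\<dots> = (\<Prod>i<CARD('n). (?s ! i)\<^sup>2 + x)"
      by (simp add: prod.list_conv_set_nth length_singular_values atLeast0LessThan)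
    finally show ?thesis .
  qed
  also have "(\<Prod>i<CARD('n). (?s ! i)\<^sup>2 + x)
      = (\<Sum>J\<in>Pow {..<CARD('n)}. (\<Prod>i\<in>J. (?s ! i)\<^sup>2) * x ^ (CARD('n) - card J))" for x
    by (subst prod_add) (auto intro!: sum.cong simp: card_Diff_subset finite_subset)
  finally show ?thesis
    using eq_coeffs_by_card[of "UNIV :: 'n set" "CARD('n)" "{..<CARD('n)}" k
        "\<lambda>J. minor J ?S id id" "\<lambda>J. \<Prod>i\<in>J. (?s ! i)\<^sup>2"] assms(2)
    by (simp add: gram_coeff_def)
qed

section \<open>Submultiplicativity\<close>

lemma permutes_if_bij: "bij p \<Longrightarrow> (\<And>x. x \<notin> J \<Longrightarrow> p x = x) \<Longrightarrow> p permutes J"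
  by (simp add: permutes_def bij_iff)

lemma conjugation_bij_betw:
  fixes r :: "'n::finite \<Rightarrow> 'n"
  assumes "bij r"
  shows "bij_betw (\<lambda>p. r \<circ> p \<circ> inv r) {p. p permutes J} {p. p permutes r ` J}"
proof (rule bij_betwI[where g = "\<lambda>p. inv r \<circ> p \<circ> r"])
  show "(\<lambda>p. r \<circ> p \<circ> inv r) \<in> {p. p permutes J} \<rightarrow> {p. p permutes r ` J}"
  proof safe
    fix p assume p: "p permutes J"
    show "(r \<circ> p \<circ> inv r) permutes (r ` J)"
    proof (rule permutes_if_bij)
      show "bij (r \<circ> p \<circ> inv r)"
        by (intro bij_comp assms permutes_bij[OF p] bij_imp_bij_inv)
    next
      fix x assume "x \<notin> r ` J"
      then have "inv r x \<notin> J"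
        using assms by (metis bij_inv_eq_iff image_eqI)
      then show "(r \<circ> p \<circ> inv r) x = x"
        using p assms by (simp add: permutes_not_in bij_is_surj surj_f_inv_f)
    qed
  qed
  show "(\<lambda>p. inv r \<circ> p \<circ> r) \<in> {p. p permutes r ` J} \<rightarrow> {p. p permutes J}"
  proof safe
    fix p assume p: "p permutes r ` J"
    show "(inv r \<circ> p \<circ> r) permutes J"
    proof (rule permutes_if_bij)
      show "bij (inv r \<circ> p \<circ> r)"
        by (intro bij_comp assms permutes_bij[OF p] bij_imp_bij_inv)
    next
      fix x assume "x \<notin> J"
      then have "r x \<notin> r ` J"
        using assms by (auto simp: bij_def inj_def)
      then show "(inv r \<circ> p \<circ> r) x = x"
        using p assms by (simp add: permutes_not_in bij_is_inj)
    qed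
  qed
qed (use assms in \<open>auto simp: fun_eq_iff bij_is_inj bij_is_surj surj_f_inv_f\<close>)

text \<open>Allows the columns of a minor to be taken as its index set, the form in which minors occur in
  \<open>gram_coeff\<close>.\<close>

lemma minor_conjugate:
  fixes r :: "'n::finite \<Rightarrow> 'n"
  assumes "bij r"
  shows "minor (r ` J) M a id = minor J M (a \<circ> r) r"
proof -
  have "minor (r ` J) M a id = (\<Sum>p | p permutes J. of_int (sign (r \<circ> p \<circ> inv r)) *
      (\<Prod>i\<in>r ` J. M $ a i $ id ((r \<circ> p \<circ> inv r) i)))"
    unfolding minor_def by (rule sum.reindex_bij_betw[OF conjugation_bij_betw[OF assms], symmetric])
  also have "\<dots> = minor J M (a \<circ> r) r"
    unfolding minor_def
  proof (rule sum.cong[OF refl], clarify)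
    fix p assume p: "p permutes J"
    have "permutation s" if "bij s" for s :: "'n \<Rightarrow> 'n"
      using permutes_imp_permutation[of UNIV s] permutes_if_bij[OF that, of UNIV] by simp
    then have "permutation r" "permutation (inv r)" "permutation p"
      using assms bij_imp_bij_inv[OF assms] permutes_bij[OF p] by simp_all
    then have "sign (r \<circ> p \<circ> inv r) = sign p"
      by (simp add: sign_compose permutation_compose sign_inverse)
    moreover have "(\<Prod>i\<in>r ` J. M $ a i $ id ((r \<circ> p \<circ> inv r) i)) = (\<Prod>i\<in>J. M $ (a \<circ> r) i $ r (p i))"
      using assms by (subst prod.reindex) (auto simp: bij_def intro: inj_on_subset)
    ultimately show "of_int (sign (r \<circ> p \<circ> inv r)) * (\<Prod>i\<in>r ` J. M $ a i $ id ((r \<circ> p \<circ> inv r) i))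
        = of_int (sign p) * (\<Prod>i\<in>J. M $ (a \<circ> r) i $ r (p i))"
      by simp
  qed
  finally show ?thesis .
qed

lemma inj_on_extends_to_bij:
  fixes b :: "'n::finite \<Rightarrow> 'n"
  assumes "inj_on b J"
  obtains r where "bij r" "\<And>i. i \<in> J \<Longrightarrow> r i = b i"
proof -
  have "card (- J) = card (- (b ` J))"
    using assms by (simp add: Compl_eq_Diff_UNIV card_Diff_subset card_image)
  then obtain g where g: "bij_betw g (- J) (- (b ` J))"
    using finite_same_card_bij[of "- J" "- (b ` J)"] by auto
  define r where "r = (\<lambda>i. if i \<in> J then b i else g i)"
  have "bij_betw r J (b ` J)"
    using assms by (auto simp: r_def bij_betw_def inj_on_def)
  moreover have "bij_betw r (- J) (- (b ` J))"
    using g bij_betw_cong[of "- J" r g] by (simp add: r_def)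
  ultimately have "bij_betw r (J \<union> - J) (b ` J \<union> - (b ` J))"
    by (intro bij_betw_combine) auto
  then have "bij r"
    by simp
  then show ?thesis
    by (rule that) (simp add: r_def)
qed

lemma gram_coeff_nonneg: "gram_coeff k M \<ge> 0"
  unfolding gram_coeff_def by (intro sum_nonneg minor_gram_nonneg)

text \<open>A minor with a repeated column vanishes. Otherwise re-indexing by its set of columns \<open>K\<close> exhibits
  its square as one of the summands of \<open>k! * minor K (M\<^sup>T M) id id\<close>, and this principal minor is one of
  the nonnegative summands of \<open>gram_coeff k M\<close>.\<close>

lemma minor_sq_le_gram_coeff:
  fixes M :: "real ^ 'n ^ 'n"
  shows "(minor J M a b)\<^sup>2 \<le> fact (card J) * gram_coeff (card J) M"
proof (cases "inj_on b J")
  case False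
  with gram_coeff_nonneg[of "card J" M] show ?thesis
    by (simp add: minor_eq_0_if_not_inj)
next
  case True
  then obtain r where r: "bij r" "\<And>i. i \<in> J \<Longrightarrow> r i = b i"
    using inj_on_extends_to_bij by blast
  define K where "K = r ` J"
  have card: "card K = card J"
    using r(1) unfolding K_def by (intro card_image) (auto simp: bij_def intro: inj_on_subset)
  define c where "c = restrict (a \<circ> inv r) K"
  have "minor J M a b = minor J M (c \<circ> r) r"
    by (intro minor_cong) (simp_all add: c_def K_def bij_is_inj[OF r(1)] r(2)[symmetric])
  also have "\<dots> = minor K M c id"
    unfolding K_def by (rule minor_conjugate[OF r(1), symmetric])
  finally have "(minor J M a b)\<^sup>2 = (minor K M c id)\<^sup>2"
    by simp
  also have "\<dots> \<le> (\<Sum>c\<in>K \<rightarrow>\<^sub>E UNIV. (minor K M c id)\<^sup>2)"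
    by (rule member_le_sum) (auto simp: c_def finite_PiE)
  also have "\<dots> = fact (card K) * minor K (transpose M ** M) id id"
    by (rule minor_gram[symmetric])
  also have "\<dots> \<le> fact (card K) * gram_coeff (card K) M"
    unfolding gram_coeff_def
    by (intro mult_left_mono member_le_sum) (auto intro: minor_gram_nonneg)
  finally show ?thesis
    by (simp add: card)
qed

text \<open>The Cauchy-Binet sum has \<open>CARD('n) ^ k\<close> terms, and each is at most \<open>k! \<surd>(e\<^sub>k(M) e\<^sub>k(N))\<close> by
  \<open>minor_sq_le_gram_coeff\<close>; the factorials cancel.\<close>

lemma minor_mult_sq_le:
  fixes M N :: "real ^ 'n ^ 'n"
  shows "(minor J (M ** N) a c)\<^sup>2
    \<le> (real CARD('n) ^ card J)\<^sup>2 * (gram_coeff (card J) M * gram_coeff (card J) N)"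
proof -
  define k where "k = card J"
  define s where "s = sqrt (gram_coeff k M) * sqrt (gram_coeff k N)"
  have bound: "\<bar>minor J X a' b'\<bar> \<le> sqrt (fact k) * sqrt (gram_coeff k X)" for X :: "real ^ 'n ^ 'n" and a' b'
    using minor_sq_le_gram_coeff[of J X a' b']
    by (simp add: k_def real_le_rsqrt flip: real_sqrt_mult)
  have "fact k * \<bar>minor J (M ** N) a c\<bar> = \<bar>\<Sum>b\<in>J \<rightarrow>\<^sub>E UNIV. minor J M a b * minor J N b c\<bar>"
    unfolding cauchy_binet[symmetric] k_def by (simp add: abs_mult)
  also have "\<dots> \<le> (\<Sum>b\<in>J \<rightarrow>\<^sub>E (UNIV :: 'n set). \<bar>minor J M a b\<bar> * \<bar>minor J N b c\<bar>)"
    by (rule order.trans[OF sum_abs]) (simp add: abs_mult)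
  also have "\<dots> \<le> real (card (J \<rightarrow>\<^sub>E (UNIV :: 'n set))) * (fact k * s)"
  proof (rule sum_bounded_above)
    fix b
    have "\<bar>minor J M a b\<bar> * \<bar>minor J N b c\<bar>
        \<le> (sqrt (fact k) * sqrt (gram_coeff k M)) * (sqrt (fact k) * sqrt (gram_coeff k N))"
      by (intro mult_mono bound) (auto simp: gram_coeff_nonneg)
    also have "\<dots> = (sqrt (fact k) * sqrt (fact k)) * s"
      by (simp only: s_def mult_ac)
    finally show "\<bar>minor J M a b\<bar> * \<bar>minor J N b c\<bar> \<le> fact k * s"
      by simp
  qed
  also have "\<dots> = fact k * (real CARD('n) ^ k * s)"
    by (simp add: card_PiE k_def)
  finally have "\<bar>minor J (M ** N) a c\<bar> \<le> real CARD('n) ^ k * s"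
    by (rule mult_left_le_imp_le) simp
  then have "(minor J (M ** N) a c)\<^sup>2 \<le> (real CARD('n) ^ k * s)\<^sup>2"
    by (metis abs_ge_zero power2_abs power_mono)
  also have "s\<^sup>2 = gram_coeff k M * gram_coeff k N"
    by (simp add: s_def power_mult_distrib gram_coeff_nonneg)
  then have "(real CARD('n) ^ k * s)\<^sup>2 = (real CARD('n) ^ k)\<^sup>2 * (gram_coeff k M * gram_coeff k N)"
    by (simp only: power_mult_distrib)
  finally show ?thesis
    unfolding k_def .
qed

text \<open>Summing \<open>minor_mult_sq_le\<close> over all minors only costs a constant. The constant is harmless for
  exponential growth rates, so crude counting suffices.\<close>

lemma gram_coeff_mult_le:
  obtains C where "C > 0"
    and "\<And>M N :: real ^ 'n ^ 'n. gram_coeff k (M ** N) \<le> C * (gram_coeff k M * gram_coeff k N)"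
proof
  \<comment> \<open>\<open>CARD('n) ^ k\<close> choices of rows in \<open>minor_gram\<close>, then the constant of \<open>minor_mult_sq_le\<close>\<close>
  define D where "D = real CARD('n) ^ k * (real CARD('n) ^ k)\<^sup>2"
  define C where "C = real CARD('n set) * D"
  show "C > 0"
    by (simp add: C_def D_def)
  fix M N :: "real ^ 'n ^ 'n"
  let ?g = "gram_coeff k M * gram_coeff k N"
  have g: "?g \<ge> 0"
    by (simp add: gram_coeff_nonneg)
  have each: "minor J (transpose (M ** N) ** (M ** N)) id id \<le> D * ?g" if "card J = k" for J
  proof -
    have "minor J (transpose (M ** N) ** (M ** N)) id id
        \<le> fact k * minor J (transpose (M ** N) ** (M ** N)) id id"
      using mult_right_mono[OF fact_ge_1 minor_gram_nonneg] by simp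
    also have "\<dots> = (\<Sum>b\<in>J \<rightarrow>\<^sub>E UNIV. (minor J (M ** N) b id)\<^sup>2)"
      using minor_gram[of J "M ** N"] that by simp
    also have "\<dots> \<le> real (card (J \<rightarrow>\<^sub>E (UNIV :: 'n set))) * ((real CARD('n) ^ k)\<^sup>2 * ?g)"
      using minor_mult_sq_le that by (intro sum_bounded_above) auto
    also have "\<dots> = D * ?g"
      using that by (simp add: card_PiE D_def)
    finally show ?thesis .
  qed
  have "gram_coeff k (M ** N) \<le> real (card {J :: 'n set. card J = k}) * (D * ?g)"
    unfolding gram_coeff_def[of k "M ** N"] using each by (intro sum_bounded_above) auto
  also have "\<dots> \<le> real CARD('n set) * (D * ?g)"
    using g card_mono[of "UNIV :: 'n set set" "{J. card J = k}"]
    by (intro mult_right_mono) (auto simp: D_def simp del: card_set)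
  finally show "gram_coeff k (M ** N) \<le> C * ?g"
    by (simp add: C_def mult.assoc)
qed

section \<open>Growth of singular values along powers of a matrix\<close>

primrec mat_pow :: "real ^ 'n ^ 'n \<Rightarrow> nat \<Rightarrow> real ^ 'n ^ 'n" where
  "mat_pow B 0 = mat 1"
| "mat_pow B (Suc n) = B ** mat_pow B n"

lemma mat_pow_add: "mat_pow B (m + n) = mat_pow B m ** mat_pow B n"
  by (induction m) (simp_all add: matrix_mul_lid matrix_mul_assoc)

lemma det_mat_pow: "det (mat_pow B n) = det B ^ n"
  by (induction n) (simp_all add: det_mul)

lemma invertible_mat_pow: "invertible B \<Longrightarrow> invertible (mat_pow B n)"
  by (simp add: invertible_det_nz det_mat_pow)

lemma mat_pow_inverse:
  assumes "C ** B = mat 1"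
  shows "mat_pow C n ** mat_pow B n = mat 1"
proof (induction n)
  case (Suc n)
  have "mat_pow C (Suc n) ** mat_pow B (Suc n) = mat_pow C (n + 1) ** mat_pow B (1 + n)"
    by simp
  also have "\<dots> = mat_pow C n ** (C ** B) ** mat_pow B n"
    unfolding mat_pow_add by (simp add: matrix_mul_assoc)
  finally show ?case
    using Suc by (simp add: assms)
qed simp

text \<open>Exchange argument: match the elements of \<open>J\<close> outside the initial segment with the missing elements
  of the segment; each replacement moves to a smaller index, where \<open>y\<close> is at least as large.\<close>

lemma prod_le_prod_initial_segment:
  fixes y :: "nat \<Rightarrow> real"
  assumes nonneg: "\<And>i. i < d \<Longrightarrow> 0 \<le> y i"
    and anti: "\<And>i j. i \<le> j \<Longrightarrow> j < d \<Longrightarrow> y j \<le> y i"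
    and J: "J \<subseteq> {..<d}"
  shows "(\<Prod>i\<in>J. y i) \<le> (\<Prod>i<card J. y i)"
proof -
  define k where "k = card J"
  have fin: "finite J"
    using J finite_subset by blast
  have k: "k \<le> d"
    using card_mono[OF _ J] by (simp add: k_def)
  have "card (J - {..<k}) = card J - card (J \<inter> {..<k})"
    using fin by (subst card_Diff_subset_Int) (auto simp: Int_commute)
  moreover have "card ({..<k} - J) = k - card (J \<inter> {..<k})"
    using fin by (subst card_Diff_subset_Int) (auto simp: Int_commute)
  ultimately obtain h where h: "bij_betw h (J - {..<k}) ({..<k} - J)"
    using finite_same_card_bij[of "J - {..<k}" "{..<k} - J"] fin by (auto simp: k_def)
  have "(\<Prod>i\<in>J - {..<k}. y i) \<le> (\<Prod>i\<in>J - {..<k}. y (h i))"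
  proof (rule prod_mono)
    fix i assume i: "i \<in> J - {..<k}"
    then have "h i \<in> {..<k} - J"
      using h by (auto simp: bij_betw_def)
    with i J show "0 \<le> y i \<and> y i \<le> y (h i)"
      by (auto intro!: nonneg anti)
  qed
  also have "\<dots> = (\<Prod>i\<in>{..<k} - J. y i)"
    by (rule prod.reindex_bij_betw[OF h])
  finally have "(\<Prod>i\<in>J \<inter> {..<k}. y i) * (\<Prod>i\<in>J - {..<k}. y i)
      \<le> (\<Prod>i\<in>J \<inter> {..<k}. y i) * (\<Prod>i\<in>{..<k} - J. y i)"
    using J by (intro mult_left_mono prod_nonneg nonneg) auto
  also have "(\<Prod>i\<in>J \<inter> {..<k}. y i) * (\<Prod>i\<in>J - {..<k}. y i) = (\<Prod>i\<in>J. y i)"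
    using fin by (rule prod.Int_Diff[symmetric])
  also have "(\<Prod>i\<in>J \<inter> {..<k}. y i) * (\<Prod>i\<in>{..<k} - J. y i) = (\<Prod>i<k. y i)"
    using prod.Int_Diff[of "{..<k}" y J] by (simp add: Int_commute)
  finally show ?thesis
    by (simp add: k_def)
qed

definition top_product :: "nat \<Rightarrow> real ^ 'n ^ 'n \<Rightarrow> real" where
  "top_product k M = (\<Prod>i<k. singular_values M ! i)"

lemma top_product_pos:
  fixes M :: "real ^ 'n ^ 'n"
  assumes "invertible M" "k \<le> CARD('n)"
  shows "top_product k M > 0"
  unfolding top_product_def using assms(2)
  by (intro prod_pos) (auto intro!: singular_values_pos[OF assms(1)] nth_mem simp: length_singular_values)

text \<open>The largest of the at most \<open>2 ^ CARD('n)\<close> terms of the elementary symmetric function is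
  \<open>(\<alpha>\<^sub>1 \<cdots> \<alpha>\<^sub>k)\<^sup>2\<close>.\<close>

lemma gram_coeff_bounds:
  fixes M :: "real ^ 'n ^ 'n"
  assumes M: "invertible M" and k: "k \<le> CARD('n)"
  shows "(top_product k M)\<^sup>2 \<le> gram_coeff k M"
    and "gram_coeff k M \<le> 2 ^ CARD('n) * (top_product k M)\<^sup>2"
proof -
  let ?y = "\<lambda>i. (singular_values M ! i)\<^sup>2" and ?d = "CARD('n)"
  let ?F = "{J. J \<subseteq> {..<?d} \<and> card J = k}"
  have pos: "singular_values M ! i > 0" if "i < ?d" for i
    using singular_values_pos[OF M] that by (simp add: length_singular_values)
  have top: "(\<Prod>i<k. ?y i) = (top_product k M)\<^sup>2"
    by (simp add: top_product_def prod_power_distrib)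
  have fin: "finite ?F"
    by (rule finite_subset[of _ "Pow {..<?d}"]) auto
  have e: "gram_coeff k M = (\<Sum>J\<in>?F. \<Prod>i\<in>J. ?y i)"
    by (rule gram_coeff_eq_elementary_symmetric[OF assms])
  have "(\<Prod>i<k. ?y i) \<le> (\<Sum>J\<in>?F. \<Prod>i\<in>J. ?y i)"
    by (rule member_le_sum[OF _ _ fin]) (use k in \<open>auto intro: prod_nonneg\<close>)
  then show "(top_product k M)\<^sup>2 \<le> gram_coeff k M"
    by (simp add: e top)
  have "(\<Prod>i\<in>J. ?y i) \<le> (\<Prod>i<card J. ?y i)" if "J \<subseteq> {..<?d}" for J
  proof (rule prod_le_prod_initial_segment[OF _ _ that])
    fix i j assume "i \<le> j" "j < ?d"
    then show "?y j \<le> ?y i"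
      using pos[of j] singular_values_antimono[of i j M]
      by (intro power_mono) (auto simp: length_singular_values)
  qed simp
  then have "gram_coeff k M \<le> real (card ?F) * (top_product k M)\<^sup>2"
    unfolding e by (intro sum_bounded_above) (auto simp flip: top)
  also have "card ?F \<le> 2 ^ ?d"
    using card_mono[of "Pow {..<?d}" ?F] by (auto simp: card_Pow)
  then have "real (card ?F) * (top_product k M)\<^sup>2 \<le> 2 ^ ?d * (top_product k M)\<^sup>2"
    by (intro mult_right_mono) (auto simp flip: of_nat_le_iff)
  finally show "gram_coeff k M \<le> 2 ^ ?d * (top_product k M)\<^sup>2" .
qed

lemma gram_coeff_pos:
  fixes M :: "real ^ 'n ^ 'n"
  assumes "invertible M" "k \<le> CARD('n)"
  shows "gram_coeff k M > 0"
  using gram_coeff_bounds(1)[OF assms] top_product_pos[OF assms]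
  by (meson less_le_trans zero_less_power)

text \<open>The constant \<open>C\<close> is absorbed by passing to \<open>ln (C e\<^sub>k(B\<^sup>n))\<close>, which is subadditive. A linear lower
  bound comes from \<open>e\<^sub>k(1) \<le> C e\<^sub>k(B\<^sup>-\<^sup>n) e\<^sub>k(B\<^sup>n)\<close>, in which the factor with \<open>B\<^sup>-\<^sup>n\<close> grows at most
  exponentially.\<close>

lemma gram_coeff_growth:
  fixes B :: "real ^ 'n ^ 'n"
  assumes B: "invertible B" and k: "k \<le> CARD('n)"
  shows "convergent (\<lambda>n. ln (gram_coeff k (mat_pow B n)) / real n)"
proof -
  obtain C where C: "C > 0"
    "\<And>M N :: real ^ 'n ^ 'n. gram_coeff k (M ** N) \<le> C * (gram_coeff k M * gram_coeff k N)"
    by (rule gram_coeff_mult_le[where k = k]) (rule that)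
  define u where "u = (\<lambda>X :: real ^ 'n ^ 'n. \<lambda>n. ln (C * gram_coeff k (mat_pow X n)))"
  have sub: "u X (m + n) \<le> u X m + u X n" if "invertible X" for X m n
  proof -
    note pos = gram_coeff_pos[OF invertible_mat_pow[OF that] k]
    have "C * gram_coeff k (mat_pow X (m + n))
        \<le> C * (C * (gram_coeff k (mat_pow X m) * gram_coeff k (mat_pow X n)))"
      unfolding mat_pow_add using C by (intro mult_left_mono) auto
    then have "u X (m + n) \<le> ln ((C * gram_coeff k (mat_pow X m)) * (C * gram_coeff k (mat_pow X n)))"
      unfolding u_def using C(1) pos by (subst ln_le_cancel_iff) (auto simp: mult_ac)
    also have "\<dots> = u X m + u X n"
      unfolding u_def using C(1) pos[of m] pos[of n] by (intro ln_mult_pos) auto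
    finally show ?thesis .
  qed
  obtain D where DB: "D ** B = mat 1" and D: "invertible D"
    using B by (auto simp: invertible_def)
  have linear: "u D n \<le> real n * u D 1 + u D 0" for n
  proof (induction n)
    case (Suc n)
    show ?case
      using sub[OF D, of 1 n] Suc by (simp add: algebra_simps)
  qed simp
  have "(- u D 1) * real n \<le> u B n" for n
  proof -
    note posB = gram_coeff_pos[OF invertible_mat_pow[OF B, of n] k]
      and posD = gram_coeff_pos[OF invertible_mat_pow[OF D, of n] k]
    have "gram_coeff k (mat_pow D 0) \<le> C * (gram_coeff k (mat_pow D n) * gram_coeff k (mat_pow B n))"
      using C(2)[of "mat_pow D n" "mat_pow B n"] by (simp add: mat_pow_inverse[OF DB])
    then have "C * gram_coeff k (mat_pow D 0)
        \<le> (C * gram_coeff k (mat_pow D n)) * (C * gram_coeff k (mat_pow B n))"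
      using C(1) by (simp add: mult_ac)
    then have "u D 0 \<le> ln ((C * gram_coeff k (mat_pow D n)) * (C * gram_coeff k (mat_pow B n)))"
      unfolding u_def using C(1) posB posD gram_coeff_pos[OF invertible_mat_pow[OF D, of 0] k]
      by (subst ln_le_cancel_iff) auto
    also have "\<dots> = u D n + u B n"
      unfolding u_def using C(1) posB posD by (intro ln_mult_pos) auto
    finally show ?thesis
      using linear[of n] by (simp add: algebra_simps)
  qed
  then obtain L where L: "(\<lambda>n. u B n / real n) \<longlonglongrightarrow> L"
    by (rule fekete[of "u B" "- u D 1", OF sub[OF B]])
  have "ln (gram_coeff k (mat_pow B n)) / real n = u B n / real n - ln C / real n" for n
    unfolding u_def using C(1) gram_coeff_pos[OF invertible_mat_pow[OF B, of n] k]
    by (simp add: ln_mult_pos diff_divide_distrib[symmetric])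
  moreover have "(\<lambda>n. u B n / real n - ln C / real n) \<longlonglongrightarrow> L - 0"
    by (intro tendsto_diff L lim_const_over_n)
  ultimately show ?thesis
    by (auto simp: convergent_def)
qed

text \<open>By \<open>gram_coeff_bounds\<close>, \<open>2 ln (\<alpha>\<^sub>1 \<cdots> \<alpha>\<^sub>k)\<close> differs from \<open>ln e\<^sub>k\<close> by a bounded amount \<open>r\<close>.\<close>

lemma top_product_growth:
  fixes B :: "real ^ 'n ^ 'n"
  assumes B: "invertible B" and k: "k \<le> CARD('n)"
  shows "convergent (\<lambda>n. ln (top_product k (mat_pow B n)) / real n)"
proof -
  obtain L where L: "(\<lambda>n. ln (gram_coeff k (mat_pow B n)) / real n) \<longlonglongrightarrow> L"
    using gram_coeff_growth[OF assms] by (auto simp: convergent_def)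
  define r where "r = (\<lambda>n. ln (gram_coeff k (mat_pow B n)) - 2 * ln (top_product k (mat_pow B n)))"
  have r: "0 \<le> r n" "r n \<le> real CARD('n) * ln 2" for n
  proof -
    note inv = invertible_mat_pow[OF B, of n]
    note pos = top_product_pos[OF inv k] gram_coeff_pos[OF inv k]
    have sq: "ln ((top_product k (mat_pow B n))\<^sup>2) = 2 * ln (top_product k (mat_pow B n))"
      using pos(1) by (simp add: ln_realpow)
    have "ln ((top_product k (mat_pow B n))\<^sup>2) \<le> ln (gram_coeff k (mat_pow B n))"
      using gram_coeff_bounds(1)[OF inv k] pos by (subst ln_le_cancel_iff) auto
    then show "0 \<le> r n"
      by (simp add: r_def sq)
    have "ln (gram_coeff k (mat_pow B n)) \<le> ln (2 ^ CARD('n) * (top_product k (mat_pow B n))\<^sup>2)"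
      using gram_coeff_bounds(2)[OF inv k] pos by (subst ln_le_cancel_iff) auto
    also have "\<dots> = real CARD('n) * ln 2 + 2 * ln (top_product k (mat_pow B n))"
      using pos by (simp add: ln_mult_pos ln_realpow sq)
    finally show "r n \<le> real CARD('n) * ln 2"
      by (simp add: r_def)
  qed
  have "(\<lambda>n. r n / real n) \<longlonglongrightarrow> 0"
    by (rule tendsto_sandwich[OF _ _ tendsto_const lim_const_over_n[of "real CARD('n) * ln 2"]])
      (use r in \<open>auto intro!: always_eventually divide_right_mono\<close>)
  with L have "(\<lambda>n. (ln (gram_coeff k (mat_pow B n)) / real n - r n / real n) / 2) \<longlonglongrightarrow> (L - 0) / 2"
    by (intro tendsto_divide tendsto_diff) auto
  moreover have "(ln (gram_coeff k (mat_pow B n)) / real n - r n / real n) / 2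
      = ln (top_product k (mat_pow B n)) / real n" for n
    by (simp add: r_def flip: diff_divide_distrib)
  ultimately show ?thesis
    by (auto simp: convergent_def)
qed

text \<open>With \<open>\<alpha>\<^sub>l\<^sub>+\<^sub>1\<close> written as a quotient of two consecutive products, the logarithm of the singular value
  function interpolates linearly between those of \<open>\<alpha>\<^sub>1 \<cdots> \<alpha>\<^sub>l\<close> and \<open>\<alpha>\<^sub>1 \<cdots> \<alpha>\<^sub>l\<^sub>+\<^sub>1\<close>.\<close>

lemma svf_below_dim:
  fixes M :: "real ^ 'n ^ 'n"
  assumes M: "invertible M" and t: "0 \<le> t" "t < real CARD('n)" and l: "l = nat \<lfloor>t\<rfloor>"
  shows "svf t M > 0"
    and "ln (svf t M) = ln (top_product l M)
      + (t - real l) * (ln (top_product (Suc l) M) - ln (top_product l M))"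
proof -
  have l_less: "l < CARD('n)"
    using t l by linarith
  have pos: "top_product l M > 0" "top_product (Suc l) M > 0"
    using top_product_pos[OF M] l_less by auto
  have Suc: "top_product (Suc l) M = top_product l M * singular_values M ! l"
    by (simp add: top_product_def mult.commute)
  then have a: "singular_values M ! l > 0"
    using pos by (simp add: zero_less_mult_iff)
  have "(\<Prod>k = 1..l. singular_value k M) = top_product l M"
    unfolding top_product_def singular_value_def
    by (rule prod.reindex_bij_witness[of _ Suc "\<lambda>k. k - 1"]) auto
  then have eq: "svf t M = top_product l M * singular_values M ! l powr (t - real l)"
    using t by (simp add: svf_def l[symmetric] singular_value_def)
  then show "svf t M > 0"
    using pos a by simp
  show "ln (svf t M) = ln (top_product l M)
      + (t - real l) * (ln (top_product (Suc l) M) - ln (top_product l M))"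
    unfolding eq Suc using pos a by (simp add: ln_mult_pos ln_powr)
qed

lemma svf_pos:
  fixes M :: "real ^ 'n ^ 'n"
  assumes "invertible M" "0 \<le> t"
  shows "svf t M > 0"
proof (cases "t < real CARD('n)")
  case True
  then show ?thesis
    by (rule svf_below_dim(1)[OF assms _ refl])
next
  case False
  with assms show ?thesis
    by (simp add: svf_def invertible_det_nz)
qed

lemma svf_growth:
  fixes B :: "real ^ 'n ^ 'n"
  assumes B: "invertible B" and t: "0 \<le> t"
  shows "convergent (\<lambda>n. ln (svf t (mat_pow B n)) / real n)"
proof (cases "t < real CARD('n)")
  case True
  define l where "l = nat \<lfloor>t\<rfloor>"
  have l_less: "l < CARD('n)"
    using t True l_def by linarith
  obtain L L' where L: "(\<lambda>n. ln (top_product l (mat_pow B n)) / real n) \<longlonglongrightarrow> L"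
      "(\<lambda>n. ln (top_product (Suc l) (mat_pow B n)) / real n) \<longlonglongrightarrow> L'"
    using top_product_growth[OF B, of l] top_product_growth[OF B, of "Suc l"] l_less
    by (auto simp: convergent_def)
  have "ln (svf t (mat_pow B n)) / real n = ln (top_product l (mat_pow B n)) / real n
      + (t - real l) * (ln (top_product (Suc l) (mat_pow B n)) / real n - ln (top_product l (mat_pow B n)) / real n)" for n
    unfolding svf_below_dim(2)[OF invertible_mat_pow[OF B] t True l_def]
    by (simp only: add_divide_distrib diff_divide_distrib times_divide_eq_right[symmetric])
  moreover have "(\<lambda>n. ln (top_product l (mat_pow B n)) / real n
      + (t - real l) * (ln (top_product (Suc l) (mat_pow B n)) / real n - ln (top_product l (mat_pow B n)) / real n))
      \<longlonglongrightarrow> L + (t - real l) * (L' - L)"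
    by (intro tendsto_intros L)
  ultimately show ?thesis
    by (auto simp: convergent_def)
next
  case False
  have "\<forall>\<^sub>F n in sequentially. ln (svf t (mat_pow B n)) / real n = t / real CARD('n) * ln \<bar>det B\<bar>"
    using eventually_gt_at_top[of 0]
  proof eventually_elim
    case (elim n)
    then show ?case
      using False B by (simp add: svf_def det_mat_pow ln_powr ln_realpow power_abs invertible_det_nz)
  qed
  then have "(\<lambda>n. ln (svf t (mat_pow B n)) / real n) \<longlonglongrightarrow> t / real CARD('n) * ln \<bar>det B\<bar>"
    by (rule tendsto_eventually)
  then show ?thesis
    by (rule convergentI)
qed

section \<open>Cylinders generate the Borel sets of the sequence space\<close>

lemma topspace_seq_topology: "topspace (seq_topology I) = {x. \<forall>k. x k \<in> I}"
  by (auto simp: seq_topology_def)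

lemma mem_cylinder: "x \<in> cylinder I w \<longleftrightarrow> (\<forall>k. x k \<in> I) \<and> (\<forall>k<length w. x k = w ! k)"
  by (auto simp: cylinder_def topspace_seq_topology)

lemma cylinder_nth: "x \<in> cylinder I w \<Longrightarrow> k < length w \<Longrightarrow> x k = w ! k"
  by (simp add: mem_cylinder)

lemma finite_words: "finite I \<Longrightarrow> finite (words I n)"
  and card_words: "finite I \<Longrightarrow> card (words I n) = card I ^ n"
  by (simp_all add: words_def finite_lists_length_eq card_lists_length_eq)

lemma words_0: "words I 0 = {[]}"
  by (auto simp: words_def)

lemma sum_words_add: "(\<Sum>w\<in>words I (m + n). f w) = (\<Sum>u\<in>words I m. \<Sum>v\<in>words I n. f (u @ v))"
proof -
  have "(\<Sum>w\<in>words I (m + n). f w) = (\<Sum>(u, v)\<in>words I m \<times> words I n. f (u @ v))"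
    by (rule sum.reindex_bij_witness[of _ "\<lambda>(u, v). u @ v" "\<lambda>w. (take m w, drop m w)"])
      (auto simp: words_def dest: in_set_takeD in_set_dropD)
  then show ?thesis
    by (simp add: sum.cartesian_product)
qed

lemma sum_words_Suc: "(\<Sum>w\<in>words I (Suc n). f w) = (\<Sum>i\<in>I. \<Sum>v\<in>words I n. f (i # v))"
proof -
  have "(\<Sum>w\<in>words I (Suc n). f w) = (\<Sum>(i, v)\<in>I \<times> words I n. f (i # v))"
    by (rule sum.reindex_bij_witness[of _ "\<lambda>(i, v). i # v" "\<lambda>w. (hd w, tl w)"])
      (auto simp: words_def length_Suc_conv)
  then show ?thesis
    by (simp add: sum.cartesian_product)
qed

lemma openin_cylinder:
  assumes "set w \<subseteq> I"
  shows "openin (seq_topology I) (cylinder I w)"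
proof -
  let ?X = "\<lambda>k. if k < length w then {w ! k} else I"
  have "cylinder I w = (\<Pi>\<^sub>E k\<in>UNIV. ?X k)"
    using assms by (auto simp: mem_cylinder PiE_def Pi_def split: if_splits) (metis nth_mem subsetD)
  moreover have "openin (product_topology (\<lambda>_. discrete_topology I) UNIV) (\<Pi>\<^sub>E k\<in>UNIV. ?X k)"
  proof (rule product_topology_basis)
    show "openin (discrete_topology I) (?X k)" for k
      using assms by (auto simp: subset_iff)
    show "finite {k. ?X k \<noteq> topspace (discrete_topology I)}"
      by (rule finite_subset[of _ "{..<length w}"]) auto
  qed
  ultimately show ?thesis
    by (simp add: seq_topology_def)
qed

lemma openin_contains_cylinder:
  assumes "openin (seq_topology I) U" "x \<in> U"
  obtains n where "cylinder I (map x [0..<n]) \<subseteq> U"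
proof -
  obtain X where X: "x \<in> (\<Pi>\<^sub>E k\<in>UNIV. X k)" "finite {k. X k \<noteq> topspace (discrete_topology I)}"
      "(\<Pi>\<^sub>E k\<in>UNIV. X k) \<subseteq> U"
    using product_topology_open_contains_basis[OF assms(1)[unfolded seq_topology_def] assms(2)] by blast
  from X(2) obtain n where "{k. X k \<noteq> I} \<subseteq> {..<n}"
    by (auto simp: finite_nat_iff_bounded)
  then have n: "\<And>k. X k \<noteq> I \<Longrightarrow> k < n"
    by auto
  have "cylinder I (map x [0..<n]) \<subseteq> (\<Pi>\<^sub>E k\<in>UNIV. X k)"
  proof
    fix y assume y: "y \<in> cylinder I (map x [0..<n])"
    have "y k \<in> X k" for k
    proof (cases "k < n")
      case True
      with y have "y k = x k"
        by (simp add: mem_cylinder)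
      with X(1) show ?thesis by auto
    next
      case False
      with n y show ?thesis
        by (auto simp: mem_cylinder)
    qed
    then show "y \<in> (\<Pi>\<^sub>E k\<in>UNIV. X k)"
      by (simp add: PiE_UNIV_domain)
  qed
  with X(3) have "cylinder I (map x [0..<n]) \<subseteq> U"
    by (rule order.trans[rotated])
  then show ?thesis
    by (rule that)
qed

text \<open>The empty set is included to make the family closed under intersections.\<close>

definition cylinders :: "'i set \<Rightarrow> (nat \<Rightarrow> 'i) set set" where
  "cylinders I = insert {} (cylinder I ` {w. set w \<subseteq> I})"

text \<open>An open set is the union of the cylinders contained in it, and over a finite alphabet there are
  only countably many words.\<close>

lemma sets_seq_borel:
  assumes "finite I"
  shows "sets (seq_borel I) = sigma_sets {x. \<forall>k. x k \<in> I} (cylinders I)"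
proof -
  let ?\<Omega> = "{x :: nat \<Rightarrow> 'a. \<forall>k. x k \<in> I}"
  have borel: "sets (seq_borel I) = sigma_sets ?\<Omega> {U. openin (seq_topology I) U}"
    unfolding seq_borel_def topspace_seq_topology[symmetric]
    by (rule sets_measure_of) (auto dest: openin_subset)
  have "U \<in> sigma_sets ?\<Omega> (cylinders I)" if U: "openin (seq_topology I) U" for U
  proof -
    define W where "W = {w. set w \<subseteq> I \<and> cylinder I w \<subseteq> U}"
    have "countable W"
      unfolding W_def using assms
      by (intro countable_subset[OF _ countable_lists[of I]]) (auto simp: countable_finite)
    have "U \<subseteq> (\<Union>w\<in>W. cylinder I w)"
    proof
      fix x assume x: "x \<in> U"
      then have "\<forall>k. x k \<in> I"
        using openin_subset[OF U] by (auto simp: topspace_seq_topology)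
      moreover obtain n where "cylinder I (map x [0..<n]) \<subseteq> U"
        using openin_contains_cylinder[OF U x] .
      ultimately show "x \<in> (\<Union>w\<in>W. cylinder I w)"
        by (intro UN_I[of "map x [0..<n]"]) (auto simp: W_def mem_cylinder)
    qed
    then have "U = (\<Union>w\<in>W. cylinder I w)"
      by (auto simp: W_def)
    also have "\<dots> \<in> sigma_sets ?\<Omega> (cylinders I)"
    proof (rule sigma_sets_UNION)
      show "countable (cylinder I ` W)"
        using \<open>countable W\<close> by simp
      fix B assume "B \<in> cylinder I ` W"
      then show "B \<in> sigma_sets ?\<Omega> (cylinders I)"
        by (intro sigma_sets.Basic) (auto simp: W_def cylinders_def)
    qed
    finally show ?thesis .
  qed
  moreover have "B \<in> {U. openin (seq_topology I) U}" if "B \<in> cylinders I" for B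
    using that openin_cylinder by (auto simp: cylinders_def)
  ultimately show ?thesis
    unfolding borel
    by (intro antisym sigma_sets_mono) (auto intro: sigma_sets.Basic)
qed

text \<open>Two cylinders are nested if one word is a prefix of the other, and disjoint otherwise.\<close>

lemma Int_stable_cylinders: "Int_stable (cylinders I)"
proof (rule Int_stableI)
  have aux: "cylinder I u \<inter> cylinder I v \<in> cylinders I"
    if uv: "set u \<subseteq> I" "set v \<subseteq> I" "length u \<le> length v" for u v
  proof (cases "take (length u) v = u")
    case True
    then have "cylinder I u \<inter> cylinder I v = cylinder I v"
      using uv(3) by (auto simp: mem_cylinder) (metis nth_take order_less_le_trans)
    then show ?thesis
      using uv by (auto simp: cylinders_def)
  next
    case False
    then obtain k where "k < length u" "v ! k \<noteq> u ! k"
      using uv(3) by (auto simp: list_eq_iff_nth_eq)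
    then have "cylinder I u \<inter> cylinder I v = {}"
      using uv(3) by (auto simp: mem_cylinder)
    then show ?thesis
      by (simp add: cylinders_def)
  qed
  fix A B assume "A \<in> cylinders I" "B \<in> cylinders I"
  then consider "A = {} \<or> B = {}" |
      u v where "A = cylinder I u" "B = cylinder I v" "set u \<subseteq> I" "set v \<subseteq> I"
    by (auto simp: cylinders_def)
  then show "A \<inter> B \<in> cylinders I"
  proof cases
    case 1
    then show ?thesis by (auto simp: cylinders_def)
  next
    case 2
    then show ?thesis
      using aux[of u v] aux[of v u] by (cases "length u \<le> length v") (auto simp: Int_commute)
  qed
qed

lemma borel_prob_measuresD:
  assumes "finite I" "\<mu> \<in> borel_prob_measures I"
  shows "prob_space \<mu>" "sets \<mu> = sigma_sets {x. \<forall>k. x k \<in> I} (cylinders I)"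
    "space \<mu> = {x. \<forall>k. x k \<in> I}" "set w \<subseteq> I \<Longrightarrow> cylinder I w \<in> sets \<mu>"
proof -
  show "prob_space \<mu>" and sets: "sets \<mu> = sigma_sets {x. \<forall>k. x k \<in> I} (cylinders I)"
    using assms by (auto simp: borel_prob_measures_def sets_seq_borel)
  have "space \<mu> = space (seq_borel I)"
    using assms by (intro sets_eq_imp_space_eq) (simp add: borel_prob_measures_def)
  then show "space \<mu> = {x. \<forall>k. x k \<in> I}"
    by (simp add: seq_borel_def space_measure_of_conv topspace_seq_topology)
  show "set w \<subseteq> I \<Longrightarrow> cylinder I w \<in> sets \<mu>"
    unfolding sets by (auto simp: cylinders_def intro: sigma_sets.Basic)
qed

lemma measure_eqI_cylinders:
  assumes I: "finite I" and \<mu>: "\<mu> \<in> borel_prob_measures I" and \<nu>: "\<nu> \<in> borel_prob_measures I"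
    and eq: "\<And>w. set w \<subseteq> I \<Longrightarrow> measure \<mu> (cylinder I w) = measure \<nu> (cylinder I w)"
  shows "\<mu> = \<nu>"
proof (rule measure_eqI_generator_eq[OF Int_stable_cylinders])
  interpret \<mu>: prob_space \<mu> by (rule borel_prob_measuresD[OF I \<mu>])
  interpret \<nu>: prob_space \<nu> by (rule borel_prob_measuresD[OF I \<nu>])
  show "cylinders I \<subseteq> Pow {x. \<forall>k. x k \<in> I}"
    by (auto simp: cylinders_def mem_cylinder)
  show "sets \<mu> = sigma_sets {x. \<forall>k. x k \<in> I} (cylinders I)"
    and "sets \<nu> = sigma_sets {x. \<forall>k. x k \<in> I} (cylinders I)"
    using borel_prob_measuresD[OF I] \<mu> \<nu> by auto
  show "emeasure \<mu> X = emeasure \<nu> X" if "X \<in> cylinders I" for X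
    using that eq by (auto simp: cylinders_def \<mu>.emeasure_eq_measure \<nu>.emeasure_eq_measure)
  have "cylinder I [] = {x. \<forall>k. x k \<in> I}"
    by (auto simp: mem_cylinder)
  then have "{x. \<forall>k. x k \<in> I} \<in> cylinders I"
    unfolding cylinders_def by (metis (mono_tags) empty_set empty_subsetI image_eqI insertCI mem_Collect_eq)
  then show "range (\<lambda>_ :: nat. {x. \<forall>k. x k \<in> I}) \<subseteq> cylinders I"
    by auto
  show "(\<Union>i :: nat. {x. \<forall>k. x k \<in> I}) = {x. \<forall>k. x k \<in> I}"
    by simp
  show "emeasure \<mu> {x. \<forall>k. x k \<in> I} \<noteq> \<infinity>"
    by simp
qed

section \<open>Cylinder weights, invariance and the uniform Bernoulli measure\<close>

lemma uniform_bernoulli_unique: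
  assumes "finite I" "uniform_bernoulli I \<mu>" "uniform_bernoulli I \<nu>"
  shows "\<mu> = \<nu>"
proof (rule measure_eqI_cylinders[OF assms(1)])
  show "measure \<mu> (cylinder I w) = measure \<nu> (cylinder I w)" if "set w \<subseteq> I" for w
  proof -
    have "w \<in> words I (length w)"
      using that by (simp add: words_def)
    then show ?thesis
      using assms by (simp add: uniform_bernoulli_def)
  qed
qed (use assms in \<open>auto simp: uniform_bernoulli_def\<close>)

lemma measurable_into_seq_borel:
  assumes "finite I" and "\<And>x. x \<in> space M \<Longrightarrow> \<forall>k. f x k \<in> I"
    and "\<And>w. set w \<subseteq> I \<Longrightarrow> f -` cylinder I w \<inter> space M \<in> sets M"
  shows "f \<in> measurable M (seq_borel I)"
proof (rule measurable_sigma_sets[OF sets_seq_borel[OF assms(1)]])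
  show "cylinders I \<subseteq> Pow {x. \<forall>k. x k \<in> I}"
    by (auto simp: cylinders_def mem_cylinder)
  show "f -` B \<inter> space M \<in> sets M" if "B \<in> cylinders I" for B
    using that assms(3) by (auto simp: cylinders_def)
qed (use assms(2) in auto)

lemma borel_prob_measures_distr:
  assumes "prob_space M" "f \<in> measurable M (seq_borel I)"
  shows "distr M (seq_borel I) f \<in> borel_prob_measures I"
  using assms by (simp add: borel_prob_measures_def prob_space.prob_space_distr)

text \<open>The infinite product of the uniform distribution on \<open>I\<close>, transported along the identity because
  the product sigma-algebra and the Borel sigma-algebra are given by different generators.\<close>

lemma uniform_bernoulli_exists:
  assumes I: "finite I" "I \<noteq> {}"
  shows "\<exists>\<mu>. uniform_bernoulli I \<mu>"
proof -
  let ?u = "uniform_count_measure I"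
  define P where "P = PiM (UNIV :: nat set) (\<lambda>_. ?u)"
  interpret u: prob_space ?u
    by (rule prob_space_uniform_count_measure[OF I])
  interpret P: product_prob_space "\<lambda>_ :: nat. ?u" UNIV
    by unfold_locales
  have space: "space P = {x. \<forall>k. x k \<in> I}"
    by (auto simp: P_def space_PiM space_uniform_count_measure PiE_def)
  have emb: "cylinder I w = prod_emb UNIV (\<lambda>_. ?u) {..<length w} (\<Pi>\<^sub>E k\<in>{..<length w}. {w ! k})" for w
    by (auto simp: mem_cylinder prod_emb_def space_uniform_count_measure PiE_def Pi_def extensional_def
        restrict_def)
  have atom: "{w ! k} \<in> sets ?u" if "set w \<subseteq> I" "k < length w" for w k
    using that by (auto simp: sets_uniform_count_measure)
  have cyl: "cylinder I w \<in> sets P" if "set w \<subseteq> I" for w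
    unfolding emb P_def using atom[OF that] by (intro sets_PiM_I) auto
  have sub: "cylinder I w \<subseteq> space P" for w
    by (auto simp: space mem_cylinder)
  have meas: "id \<in> measurable P (seq_borel I)"
    by (rule measurable_into_seq_borel[OF I(1)])
      (use cyl sub in \<open>auto simp: space Int_absorb2\<close>)
  have "prob_space P"
    unfolding P_def by (rule P.prob_space_axioms)
  define \<mu> where "\<mu> = distr P (seq_borel I) id"
  have \<mu>: "\<mu> \<in> borel_prob_measures I"
    unfolding \<mu>_def by (rule borel_prob_measures_distr) fact+
  have "measure \<mu> (cylinder I w) = 1 / real (card I) ^ n" if w: "w \<in> words I n" for w n
  proof -
    have w': "set w \<subseteq> I" "length w = n"
      using w by (auto simp: words_def)
    have "cylinder I w \<in> sets (seq_borel I)"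
      using borel_prob_measuresD(4)[OF I(1) \<mu> w'(1)] \<mu> by (simp add: borel_prob_measures_def)
    then have "measure \<mu> (cylinder I w) = measure P (cylinder I w)"
      unfolding \<mu>_def using meas sub by (subst measure_distr) (auto simp: Int_absorb2)
    also have "\<dots> = (\<Prod>k<length w. measure ?u {w ! k})"
      unfolding emb P_def using atom[OF w'(1)] by (intro P.measure_PiM_emb) auto
    also have "\<dots> = (\<Prod>k<length w. 1 / real (card I))"
    proof (intro prod.cong refl)
      fix k assume "k \<in> {..<length w}"
      then have "w ! k \<in> I"
        using w'(1) by auto
      then show "measure ?u {w ! k} = 1 / real (card I)"
        using I by (simp add: measure_uniform_count_measure)
    qed
    finally show ?thesis
      by (simp add: w' power_one_over)
  qed
  with \<mu> show ?thesis
    by (auto simp: uniform_bernoulli_def)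
qed

context
  fixes I :: "'i set" and \<mu> :: "(nat \<Rightarrow> 'i) measure"
  assumes I: "finite I" and \<mu>: "\<mu> \<in> borel_prob_measures I"
begin

interpretation prob_space \<mu>
  by (rule borel_prob_measuresD[OF I \<mu>])

lemma sum_measure_cylinder_append:
  assumes "set u \<subseteq> I"
  shows "(\<Sum>v\<in>words I n. measure \<mu> (cylinder I (u @ v))) = measure \<mu> (cylinder I u)"
proof -
  have "(\<Sum>v\<in>words I n. measure \<mu> (cylinder I (u @ v)))
      = measure \<mu> (\<Union>v\<in>words I n. cylinder I (u @ v))"
  proof (rule finite_measure_finite_Union[symmetric])
    show "finite (words I n)"
      by (rule finite_words[OF I])
    show "(\<lambda>v. cylinder I (u @ v)) ` words I n \<subseteq> sets \<mu>"
      using assms borel_prob_measuresD(4)[OF I \<mu>] by (auto simp: words_def)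
    show "disjoint_family_on (\<lambda>v. cylinder I (u @ v)) (words I n)"
      unfolding disjoint_family_on_def
    proof (intro ballI impI)
      fix v v' assume v: "v \<in> words I n" "v' \<in> words I n" "v \<noteq> v'"
      then obtain k where k: "k < n" "v ! k \<noteq> v' ! k"
        by (auto simp: words_def list_eq_iff_nth_eq)
      have "x (length u + k) = v ! k" "x (length u + k) = v' ! k"
        if "x \<in> cylinder I (u @ v) \<inter> cylinder I (u @ v')" for x
        using that k v cylinder_nth[of x I "u @ v" "length u + k"]
          cylinder_nth[of x I "u @ v'" "length u + k"] by (auto simp: words_def)
      with k show "cylinder I (u @ v) \<inter> cylinder I (u @ v') = {}"
        by fastforce
    qed
  qed
  also have "(\<Union>v\<in>words I n. cylinder I (u @ v)) = cylinder I u"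
  proof safe
    fix v x assume "x \<in> cylinder I (u @ v)"
    then show "x \<in> cylinder I u"
      by (auto simp: mem_cylinder nth_append split: if_splits)
  next
    fix x assume "x \<in> cylinder I u"
    then show "x \<in> (\<Union>v\<in>words I n. cylinder I (u @ v))"
      by (intro UN_I[of "map (\<lambda>k. x (length u + k)) [0..<n]"])
        (auto simp: mem_cylinder words_def nth_append)
  qed
  finally show ?thesis .
qed

lemma sum_measure_cylinder: "(\<Sum>w\<in>words I n. measure \<mu> (cylinder I w)) = 1"
proof -
  have "cylinder I [] = space \<mu>"
    using borel_prob_measuresD(3)[OF I \<mu>] by (auto simp: mem_cylinder)
  with sum_measure_cylinder_append[of "[]" n] show ?thesis
    by (simp add: prob_space)
qed

lemma shift_vimage_cylinder:
  "shift -` cylinder I w \<inter> space \<mu> = (\<Union>i\<in>I. cylinder I (i # w))"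
proof (intro equalityI subsetI)
  fix x assume "x \<in> shift -` cylinder I w \<inter> space \<mu>"
  then show "x \<in> (\<Union>i\<in>I. cylinder I (i # w))"
    using borel_prob_measuresD(3)[OF I \<mu>]
    by (intro UN_I[of "x 0"]) (auto simp: mem_cylinder shift_def nth_Cons split: nat.splits)
next
  fix x assume "x \<in> (\<Union>i\<in>I. cylinder I (i # w))"
  then show "x \<in> shift -` cylinder I w \<inter> space \<mu>"
    using borel_prob_measuresD(3)[OF I \<mu>] by (auto simp: mem_cylinder shift_def)
qed

lemma measure_shift_vimage_cylinder:
  assumes "set w \<subseteq> I"
  shows "shift -` cylinder I w \<inter> space \<mu> \<in> sets \<mu>"
    and "measure \<mu> (shift -` cylinder I w \<inter> space \<mu>) = (\<Sum>i\<in>I. measure \<mu> (cylinder I (i # w)))"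
proof -
  have sets: "cylinder I (i # w) \<in> sets \<mu>" if "i \<in> I" for i
    using assms that by (intro borel_prob_measuresD(4)[OF I \<mu>]) auto
  then show "shift -` cylinder I w \<inter> space \<mu> \<in> sets \<mu>"
    unfolding shift_vimage_cylinder using I by (intro sets.finite_UN) auto
  have "x 0 = i" if "x \<in> cylinder I (i # w)" for x i
    using cylinder_nth[OF that, of 0] by simp
  then have "disjoint_family_on (\<lambda>i. cylinder I (i # w)) I"
    unfolding disjoint_family_on_def by blast
  then show "measure \<mu> (shift -` cylinder I w \<inter> space \<mu>) = (\<Sum>i\<in>I. measure \<mu> (cylinder I (i # w)))"
    unfolding shift_vimage_cylinder using I sets by (intro finite_measure_finite_Union) auto
qed

lemma measurable_shift: "shift \<in> measurable \<mu> (seq_borel I)"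
  by (rule measurable_into_seq_borel[OF I])
    (use borel_prob_measuresD(3)[OF I \<mu>] measure_shift_vimage_cylinder(1) in \<open>auto simp: shift_def\<close>)

end

text \<open>The image under the shift is again uniform on cylinders, so it is the same measure.\<close>

lemma uniform_bernoulli_invariant:
  assumes I: "finite I" "I \<noteq> {}" and \<mu>: "uniform_bernoulli I \<mu>"
  shows "\<mu> \<in> invariant_measures I"
proof -
  have bp: "\<mu> \<in> borel_prob_measures I"
    using \<mu> by (simp add: uniform_bernoulli_def)
  note D = borel_prob_measuresD[OF I(1) bp]
  have sets: "sets \<mu> = sets (seq_borel I)"
    using bp by (simp add: borel_prob_measures_def)
  note shift = measurable_shift[OF I(1) bp]
  define \<nu> where "\<nu> = distr \<mu> (seq_borel I) shift"
  have "uniform_bernoulli I \<nu>"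
    unfolding uniform_bernoulli_def
  proof (intro conjI allI ballI)
    show "\<nu> \<in> borel_prob_measures I"
      unfolding \<nu>_def by (intro borel_prob_measures_distr D shift)
    fix n w assume w: "w \<in> words I n"
    then have w': "set w \<subseteq> I" "length w = n"
      by (auto simp: words_def)
    have "measure \<nu> (cylinder I w) = (\<Sum>i\<in>I. measure \<mu> (cylinder I (i # w)))"
      using measure_shift_vimage_cylinder[OF I(1) bp w'(1)] D(4)[OF w'(1)] shift
      by (simp add: \<nu>_def measure_distr sets)
    also have "\<dots> = (\<Sum>i\<in>I. 1 / real (card I) ^ Suc n)"
    proof (rule sum.cong)
      fix i assume "i \<in> I"
      then have "i # w \<in> words I (Suc n)"
        using w' by (simp add: words_def)
      then show "measure \<mu> (cylinder I (i # w)) = 1 / real (card I) ^ Suc n"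
        using \<mu> by (simp only: uniform_bernoulli_def)
    qed simp
    also have "\<dots> = 1 / real (card I) ^ n"
      using I by simp
    finally show "measure \<nu> (cylinder I w) = 1 / real (card I) ^ n" .
  qed
  then have "\<nu> = \<mu>"
    using uniform_bernoulli_unique I(1) \<mu> by blast
  then have "measure \<mu> (shift -` B \<inter> space \<mu>) = measure \<mu> B" if "B \<in> sets \<mu>" for B
    using measure_distr[OF shift, of B] that by (simp add: \<nu>_def sets)
  with bp show ?thesis
    by (simp add: invariant_measures_def)
qed

text \<open>Summing out a prefix is where invariance enters: for a single letter the sum is the measure of
  the preimage of the cylinder under the shift.\<close>

lemma sum_measure_cylinder_prepend:
  assumes I: "finite I" and \<mu>: "\<mu> \<in> invariant_measures I" and v: "set v \<subseteq> I"
  shows "(\<Sum>u\<in>words I n. measure \<mu> (cylinder I (u @ v))) = measure \<mu> (cylinder I v)"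
proof (induction n)
  case 0
  show ?case by (simp add: words_0)
next
  case (Suc n)
  have bp: "\<mu> \<in> borel_prob_measures I"
    using \<mu> by (simp add: invariant_measures_def)
  have step: "(\<Sum>i\<in>I. measure \<mu> (cylinder I (i # w))) = measure \<mu> (cylinder I w)"
    if "set w \<subseteq> I" for w
    using measure_shift_vimage_cylinder(2)[OF I bp that] borel_prob_measuresD(4)[OF I bp that] \<mu>
    by (simp add: invariant_measures_def)
  have "(\<Sum>u\<in>words I (Suc n). measure \<mu> (cylinder I (u @ v)))
      = (\<Sum>u\<in>words I n. \<Sum>i\<in>I. measure \<mu> (cylinder I (i # u @ v)))"
    unfolding sum_words_Suc by (subst sum.swap) simp
  also have "\<dots> = (\<Sum>u\<in>words I n. measure \<mu> (cylinder I (u @ v)))"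
    using v by (intro sum.cong step) (auto simp: words_def)
  finally show ?case
    using Suc by simp
qed

section \<open>Measures of maximal entropy\<close>

lemma entropy_fun_eq: "entropy_fun x = - x * ln x"
  by (simp add: entropy_fun_def)

lemma entropy_fun_nonneg: "0 \<le> x \<Longrightarrow> x \<le> 1 \<Longrightarrow> 0 \<le> entropy_fun x"
  by (cases "x = 0") (auto simp: entropy_fun_eq mult_nonneg_nonpos)

text \<open>Gibbs' inequality for a single term, from \<open>ln x \<le> x - 1\<close> at \<open>x = q / p\<close>. After summation over two
  probability vectors the terms \<open>q - p\<close> cancel.\<close>

lemma entropy_fun_le:
  assumes "0 \<le> p" "0 \<le> q" "p > 0 \<Longrightarrow> q > 0"
  shows "entropy_fun p \<le> - p * ln q + q - p"
proof (cases "p = 0")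
  case False
  then have "p > 0" "q > 0"
    using assms by auto
  then have "p * (ln q - ln p) \<le> p * (q / p - 1)"
    using ln_le_minus_one[of "q / p"] by (intro mult_left_mono) (auto simp: ln_div)
  also have "\<dots> = q - p"
    using \<open>p > 0\<close> by (simp add: right_diff_distrib)
  finally show ?thesis
    by (simp add: entropy_fun_eq algebra_simps)
qed (use assms in \<open>simp add: entropy_fun_eq\<close>)

text \<open>\<open>ln x = x - 1\<close> holds only at \<open>x = 1\<close>.\<close>

lemma entropy_fun_eq_imp_eq:
  assumes "0 \<le> p" "0 < q" "entropy_fun p = - p * ln q + q - p"
  shows "p = q"
proof (cases "p = 0")
  case False
  then have "p > 0"
    using assms by auto
  have "p * ln (q / p) = p * (q / p - 1)"
    using assms \<open>p > 0\<close> by (simp add: entropy_fun_eq ln_div algebra_simps)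
  then have "ln (q / p) = q / p - 1"
    using \<open>p > 0\<close> by simp
  then have "q / p = 1"
    using ln_eq_minus_one[of "q / p"] assms \<open>p > 0\<close> by simp
  then show ?thesis
    using \<open>p > 0\<close> by simp
qed (use assms in \<open>simp add: entropy_fun_eq\<close>)

lemma sum_entropy_fun_le_ln_card:
  assumes "finite X" "X \<noteq> {}" "\<And>x. x \<in> X \<Longrightarrow> p x \<ge> 0" "(\<Sum>x\<in>X. p x) = 1"
  shows "(\<Sum>x\<in>X. entropy_fun (p x)) \<le> ln (real (card X))"
    and "(\<Sum>x\<in>X. entropy_fun (p x)) = ln (real (card X)) \<Longrightarrow> x \<in> X \<Longrightarrow> p x = 1 / real (card X)"
proof -
  define q where "q = 1 / real (card X)"
  have q: "q > 0"
    using assms by (simp add: q_def card_gt_0_iff)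
  have le: "entropy_fun (p x) \<le> - p x * ln q + q - p x" if "x \<in> X" for x
    using assms(3)[OF that] q by (intro entropy_fun_le) auto
  have "(\<Sum>x\<in>X. - p x * ln q + q - p x) = - (\<Sum>x\<in>X. p x) * ln q + real (card X) * q - (\<Sum>x\<in>X. p x)"
    by (simp add: sum.distrib sum_subtractf sum_distrib_right sum_negf)
  also have "\<dots> = ln (real (card X))"
    using assms q by (simp add: q_def ln_div)
  finally have total: "(\<Sum>x\<in>X. - p x * ln q + q - p x) = ln (real (card X))" .
  show "(\<Sum>x\<in>X. entropy_fun (p x)) \<le> ln (real (card X))"
    unfolding total[symmetric] by (rule sum_mono) (rule le)
  assume "(\<Sum>x\<in>X. entropy_fun (p x)) = ln (real (card X))" and x: "x \<in> X"
  then have "(\<Sum>x\<in>X. entropy_fun (p x)) = (\<Sum>x\<in>X. - p x * ln q + q - p x)"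
    using total by simp
  from sum_mono_inv[OF this le x assms(1)] have "entropy_fun (p x) = - p x * ln q + q - p x" .
  then show "p x = 1 / real (card X)"
    using entropy_fun_eq_imp_eq assms(3)[OF x] q unfolding q_def by blast
qed

text \<open>The joint entropy is at most the sum of the marginal entropies: apply \<open>entropy_fun_le\<close> to
  \<open>p u v\<close> and the product \<open>a u * b v\<close> of its marginals, and sum.\<close>

lemma sum_entropy_fun_subadditive:
  fixes p :: "'a \<Rightarrow> 'b \<Rightarrow> real"
  assumes fin: "finite U" "finite V" and nonneg: "\<And>u v. u \<in> U \<Longrightarrow> v \<in> V \<Longrightarrow> p u v \<ge> 0"
    and a: "\<And>u. u \<in> U \<Longrightarrow> (\<Sum>v\<in>V. p u v) = a u"
    and b: "\<And>v. v \<in> V \<Longrightarrow> (\<Sum>u\<in>U. p u v) = b v"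
    and total: "(\<Sum>u\<in>U. a u) = 1"
  shows "(\<Sum>u\<in>U. \<Sum>v\<in>V. entropy_fun (p u v)) \<le> (\<Sum>u\<in>U. entropy_fun (a u)) + (\<Sum>v\<in>V. entropy_fun (b v))"
proof -
  have totalb: "(\<Sum>v\<in>V. b v) = 1"
  proof -
    have "(\<Sum>v\<in>V. b v) = (\<Sum>v\<in>V. \<Sum>u\<in>U. p u v)"
      using b by simp
    also have "\<dots> = (\<Sum>u\<in>U. \<Sum>v\<in>V. p u v)"
      by (rule sum.swap)
    finally show ?thesis
      using a total by simp
  qed
  have le: "entropy_fun (p u v) \<le> - p u v * ln (a u) - p u v * ln (b v) + a u * b v - p u v"
    if uv: "u \<in> U" "v \<in> V" for u v
  proof -
    have pa: "p u v \<le> a u"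
      using member_le_sum[of v V "p u"] nonneg uv fin a[of u] by auto
    have pb: "p u v \<le> b v"
      using member_le_sum[of u U "\<lambda>u. p u v"] nonneg uv fin b[of v] by auto
    have p: "p u v \<ge> 0"
      using nonneg uv by simp
    have "entropy_fun (p u v) \<le> - p u v * ln (a u * b v) + a u * b v - p u v"
      using p pa pb by (intro entropy_fun_le) auto
    also have "- p u v * ln (a u * b v) = - p u v * ln (a u) - p u v * ln (b v)"
    proof (cases "p u v = 0")
      case False
      then have "a u > 0" "b v > 0"
        using p pa pb by auto
      then show ?thesis
        by (simp add: ln_mult_pos algebra_simps)
    qed simp
    finally show ?thesis .
  qed
  have "(\<Sum>u\<in>U. \<Sum>v\<in>V. entropy_fun (p u v))
      \<le> (\<Sum>u\<in>U. \<Sum>v\<in>V. - p u v * ln (a u) - p u v * ln (b v) + a u * b v - p u v)"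
    by (intro sum_mono le)
  also have "\<dots> = (\<Sum>u\<in>U. \<Sum>v\<in>V. - p u v * ln (a u)) - (\<Sum>u\<in>U. \<Sum>v\<in>V. p u v * ln (b v))
      + (\<Sum>u\<in>U. \<Sum>v\<in>V. a u * b v) - (\<Sum>u\<in>U. \<Sum>v\<in>V. p u v)"
    by (simp only: sum.distrib sum_subtractf)
  also have "(\<Sum>u\<in>U. \<Sum>v\<in>V. - p u v * ln (a u)) = (\<Sum>u\<in>U. entropy_fun (a u))"
    using a by (simp add: entropy_fun_eq sum_negf flip: sum_distrib_right)
  also have "(\<Sum>u\<in>U. \<Sum>v\<in>V. p u v * ln (b v)) = (\<Sum>v\<in>V. \<Sum>u\<in>U. p u v * ln (b v))"
    by (rule sum.swap)
  also have "\<dots> = - (\<Sum>v\<in>V. entropy_fun (b v))"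
    using b by (simp add: entropy_fun_eq sum_negf flip: sum_distrib_right)
  also have "(\<Sum>u\<in>U. \<Sum>v\<in>V. a u * b v) = 1"
    using total totalb by (simp flip: sum_product)
  also have "(\<Sum>u\<in>U. \<Sum>v\<in>V. p u v) = 1"
    using a total by simp
  finally show ?thesis
    by simp
qed

definition block_entropy :: "'i set \<Rightarrow> (nat \<Rightarrow> 'i) measure \<Rightarrow> nat \<Rightarrow> real" where
  "block_entropy I \<mu> n = (\<Sum>w\<in>words I n. entropy_fun (measure \<mu> (cylinder I w)))"

lemma block_entropy_nonneg:
  assumes "finite I" "\<mu> \<in> borel_prob_measures I"
  shows "block_entropy I \<mu> n \<ge> 0"
proof -
  interpret prob_space \<mu>
    by (rule borel_prob_measuresD[OF assms])
  show ?thesis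
    unfolding block_entropy_def by (intro sum_nonneg entropy_fun_nonneg) auto
qed

text \<open>The weights of the words of length \<open>m + n\<close> are a joint distribution of an initial and a final word.
  Its second marginal is the distribution of words of length \<open>n\<close> because the measure is invariant.\<close>

lemma block_entropy_subadditive:
  assumes I: "finite I" and \<mu>: "\<mu> \<in> invariant_measures I"
  shows "block_entropy I \<mu> (m + n) \<le> block_entropy I \<mu> m + block_entropy I \<mu> n"
proof -
  have bp: "\<mu> \<in> borel_prob_measures I"
    using \<mu> by (simp add: invariant_measures_def)
  show ?thesis
    unfolding block_entropy_def sum_words_add
    by (rule sum_entropy_fun_subadditive)
      (use sum_measure_cylinder_append[OF I bp] sum_measure_cylinder_prepend[OF I \<mu>]
          sum_measure_cylinder[OF I bp] finite_words[OF I] in \<open>auto simp: words_def\<close>)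
qed

lemma measure_entropy_le_block_entropy:
  assumes I: "finite I" and \<mu>: "\<mu> \<in> invariant_measures I" and "n > 0"
  shows "measure_entropy I \<mu> \<le> block_entropy I \<mu> n / real n"
proof -
  have "0 * real k \<le> block_entropy I \<mu> k" for k
    using block_entropy_nonneg[OF I] \<mu> by (simp add: invariant_measures_def)
  then obtain L where L: "(\<lambda>n. block_entropy I \<mu> n / real n) \<longlonglongrightarrow> L"
      "\<And>n. n > 0 \<Longrightarrow> L \<le> block_entropy I \<mu> n / real n"
    using fekete[of "block_entropy I \<mu>" 0, OF block_entropy_subadditive[OF I \<mu>]] by metis
  then have "measure_entropy I \<mu> = L"
    unfolding measure_entropy_def block_entropy_def by (intro limI)
  with L(2)[OF \<open>n > 0\<close>] show ?thesis
    by simp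
qed

lemma measure_entropy_uniform_bernoulli:
  assumes I: "finite I" "card I \<ge> 1" and \<mu>: "uniform_bernoulli I \<mu>"
  shows "measure_entropy I \<mu> = ln (real (card I))"
proof -
  have "block_entropy I \<mu> n / real n = ln (real (card I))" if "n > 0" for n
  proof -
    have "block_entropy I \<mu> n = (\<Sum>w\<in>words I n. entropy_fun (1 / real (card I) ^ n))"
      unfolding block_entropy_def using \<mu> by (intro sum.cong) (auto simp: uniform_bernoulli_def)
    also have "\<dots> = real n * ln (real (card I))"
      using I by (simp add: card_words entropy_fun_eq ln_div ln_realpow)
    finally show ?thesis
      using that by simp
  qed
  then have "(\<lambda>n. block_entropy I \<mu> n / real n) \<longlonglongrightarrow> ln (real (card I))"
    by (intro tendsto_eventually eventually_mono[OF eventually_gt_at_top[of 0]])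
  then show ?thesis
    unfolding measure_entropy_def block_entropy_def by (rule limI)
qed

text \<open>Since the entropy is a lower bound for all \<open>H\<^sub>n / n\<close>, maximality passes from the limit to every
  single \<open>n\<close>, where the case of equality in Gibbs' inequality applies.\<close>

lemma measure_entropy_eq_max_imp_uniform:
  assumes I: "finite I" "I \<noteq> {}" and \<mu>: "\<mu> \<in> invariant_measures I"
    and h: "measure_entropy I \<mu> = ln (real (card I))"
  shows "uniform_bernoulli I \<mu>"
  unfolding uniform_bernoulli_def
proof (intro conjI allI ballI)
  show bp: "\<mu> \<in> borel_prob_measures I"
    using \<mu> by (simp add: invariant_measures_def)
  fix n w assume w: "w \<in> words I n"
  have card: "real (card (words I n)) = real (card I) ^ n" and pos: "real (card I) > 0"
    using I by (simp_all add: card_words card_gt_0_iff)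
  have ln_card: "ln (real (card (words I n))) = real n * ln (real (card I))"
    unfolding card using pos by (simp add: ln_realpow)
  note gibbs = sum_entropy_fun_le_ln_card[of "words I n" "\<lambda>w. measure \<mu> (cylinder I w)",
      OF finite_words[OF I(1)] _ measure_nonneg sum_measure_cylinder[OF I(1) bp], folded block_entropy_def]
  have ne: "words I n \<noteq> {}"
    using w by auto
  have "real n * ln (real (card I)) \<le> block_entropy I \<mu> n"
  proof (cases "n = 0")
    case True
    then show ?thesis
      using block_entropy_nonneg[OF I(1) bp] by simp
  next
    case False
    then show ?thesis
      using measure_entropy_le_block_entropy[OF I(1) \<mu>, of n] by (simp add: h field_simps)
  qed
  with gibbs(1)[OF ne] have "block_entropy I \<mu> n = ln (real (card (words I n)))"
    unfolding ln_card by simp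
  from gibbs(2)[OF ne this w] show "measure \<mu> (cylinder I w) = 1 / real (card I) ^ n"
    by (simp add: card)
qed

section \<open>Equilibrium measures of a constant matrix tuple\<close>

lemma word_prod_constant:
  "set w \<subseteq> I \<Longrightarrow> (\<And>i. i \<in> I \<Longrightarrow> A i = B) \<Longrightarrow> word_prod A w = mat_pow B (length w)"
  by (induction w) (auto simp: word_prod_def)

theorem lemma3p5:
  fixes I :: "'i set" and A :: "'i \<Rightarrow> real ^ 'n ^ 'n" and B :: "real ^ 'n ^ 'n"
  assumes "finite I" and "card I \<ge> 2"
    and "invertible B" and "\<And>i. i \<in> I \<Longrightarrow> A i = B"
  shows "\<exists>\<mu>. (\<forall>\<nu>. uniform_bernoulli I \<nu> \<longleftrightarrow> \<nu> = \<mu>) \<and>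
    (\<forall>t\<ge>0. \<forall>\<nu>. equilibrium_measure I A t \<nu> \<longleftrightarrow> \<nu> = \<mu>)"
proof -
  have I: "finite I" "I \<noteq> {}"
    using assms by auto
  obtain \<mu> where \<mu>: "uniform_bernoulli I \<mu>"
    using uniform_bernoulli_exists[OF I] by blast
  have unique: "uniform_bernoulli I \<nu> \<longleftrightarrow> \<nu> = \<mu>" for \<nu>
    using \<mu> uniform_bernoulli_unique[OF I(1)] by blast
  have "equilibrium_measure I A t \<nu> \<longleftrightarrow> \<nu> = \<mu>" if t: "t \<ge> 0" for t \<nu>
  proof -
    define s where "s n = svf t (mat_pow B n)" for n
    have s: "s n > 0" for n
      unfolding s_def using svf_pos[OF invertible_mat_pow[OF assms(3)] t] .
    have const: "svf t (word_prod A w) = s n" if "w \<in> words I n" for w n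
      using that word_prod_constant[of w I A B] assms(4) by (simp add: words_def s_def)
    obtain L where L: "(\<lambda>n. ln (s n) / real n) \<longlonglongrightarrow> L"
      using svf_growth[OF assms(3) t] unfolding s_def by (auto simp: convergent_def)
    have "pressure I A t = ln (real (card I)) + L"
      unfolding pressure_def
    proof (rule limI)
      have "ln (\<Sum>w\<in>words I n. svf t (word_prod A w)) / real n
          = ln (real (card I)) + ln (s n) / real n" if "n > 0" for n
      proof -
        have "(\<Sum>w\<in>words I n. svf t (word_prod A w)) = real (card I) ^ n * s n"
          using const by (simp add: card_words[OF I(1)])
        also have "ln \<dots> = real n * ln (real (card I)) + ln (s n)"
          using s[of n] I by (simp add: ln_mult_pos ln_realpow card_gt_0_iff)
        finally show ?thesis
          using that by (simp add: add_divide_distrib)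
      qed
      then have "\<forall>\<^sub>F n in sequentially. ln (real (card I)) + ln (s n) / real n
          = ln (\<Sum>w\<in>words I n. svf t (word_prod A w)) / real n"
        by (intro eventually_mono[OF eventually_gt_at_top[of 0]]) simp
      moreover have "(\<lambda>n. ln (real (card I)) + ln (s n) / real n) \<longlonglongrightarrow> ln (real (card I)) + L"
        by (intro tendsto_add tendsto_const L)
      ultimately show "(\<lambda>n. ln (\<Sum>w\<in>words I n. svf t (word_prod A w)) / real n)
          \<longlonglongrightarrow> ln (real (card I)) + L"
        by (rule Lim_transform_eventually[rotated])
    qed
    moreover have "energy I A t \<nu> = L" if "\<nu> \<in> borel_prob_measures I"
      unfolding energy_def
    proof (rule limI)
      have "(\<Sum>w\<in>words I n. measure \<nu> (cylinder I w) * ln (svf t (word_prod A w))) = ln (s n)" for n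
        using sum_measure_cylinder[OF I(1) that, of n] const by (simp flip: sum_distrib_right)
      with L show "(\<lambda>n. (\<Sum>w\<in>words I n. measure \<nu> (cylinder I w) * ln (svf t (word_prod A w))) / real n)
          \<longlonglongrightarrow> L"
        by simp
    qed
    ultimately have "equilibrium_measure I A t \<nu> \<longleftrightarrow>
        \<nu> \<in> invariant_measures I \<and> measure_entropy I \<nu> = ln (real (card I))"
      by (auto simp: equilibrium_measure_def invariant_measures_def)
    also have "\<dots> \<longleftrightarrow> uniform_bernoulli I \<nu>"
      using measure_entropy_eq_max_imp_uniform[OF I] uniform_bernoulli_invariant[OF I]
        measure_entropy_uniform_bernoulli[OF I(1)] assms(2) by (metis One_nat_def Suc_leD numeral_2_eq_2)
    finally show ?thesis
      using unique by simp
  qed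
  with unique show ?thesis
    by blast
qed

end
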